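(* For each integer $m\ge2$, $$\zeta(s)=-\frac{(s-m)\,\Gamma(m)\,\Gamma(1-s)}{2\pi i}\int_{C}\frac{\mathrm{Li}_{2,1\times(m-2)}(1-e^{-x})}{x^{m}}\,(-x)^{s}\,\frac{dx}{x}$$ for all complex $s\ne1$ satisfying $\Re s<m$ (at the points $s=2,\dots,m-1$, where $\Gamma(1-s)$ has a pole, the right-hand side is understood as its limit). Here $\zeta$ is the Riemann zeta function, $C$ is the Hankel contour and $\mathrm{Li}_{2,1\times(m-2)}$ is the multiple polylogarithm, both described in the context.
   Context: $\mathrm{Li}_{2,1\times(m-2)}(z)=\mathrm{Li}_{2,1,1,\dots,1}(z)$ with the index $1$ repeated $m-2$ times is the multiple polylogarithm of depth $m-1$, $\mathrm{Li}_{2,1,\dots,1}(z)=\sum_{n_1>n_2>\dots>n_{m-1}\ge1}\frac{z^{n_1}}{n_1^2\,n_2\cdots n_{m-1}}$ for $|z|<1$, continued analytically to $\mathbb{C}\setminus[1,\infty)$ (for $m=2$ it is the dilogarithm $\mathrm{Li}_2$). $C$ is the Hankel contour: it comes from $+\infty$ just above the positive real axis to near $0$, goes around $0$ counterclockwise on a small circle, and returns to $+\infty$ just below the positive real axis (staying in $|\Im x|<\pi$). The power is $(-x)^s=e^{s\log(-x)}$, with $(-x)^s=e^{s(\log x-i\pi)}$ on the upper part of $C$ and $(-x)^s=e^{s(\log x+i\pi)}$ on the lower part. *)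

theory Defs
  imports "HOL-Complex_Analysis.Complex_Analysis"
begin

text \<open>The value at \<open>z\<close> of the holomorphic extension to \<open>D\<close> of the function \<open>f\<close> given on \<open>U\<close>.
  It is meaningful when \<open>D\<close> is open and connected, \<open>U\<close> is a nonempty open subset of \<open>D\<close>, \<open>z \<in> D\<close>
  and an extension exists; it is then unique by the identity theorem.\<close>

definition continuation ::
    "complex set \<Rightarrow> complex set \<Rightarrow> (complex \<Rightarrow> complex) \<Rightarrow> complex \<Rightarrow> complex" where
  "continuation U D f z =
     (THE w. \<exists>g. g holomorphic_on D \<and> (\<forall>u\<in>U. g u = f u) \<and> w = g z)"

lemma continuation_eqI:
  assumes "open D" "connected D" "open U" "U \<noteq> {}" "U \<subseteq> D" "z \<in> D"
    and g: "g holomorphic_on D" "\<And>u. u \<in> U \<Longrightarrow> g u = f u"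
  shows "continuation U D f z = g z"
  unfolding continuation_def
proof (rule the_equality)
  show "\<exists>g'. g' holomorphic_on D \<and> (\<forall>u\<in>U. g' u = f u) \<and> g z = g' z"
    using g by blast
next
  fix w assume "\<exists>g'. g' holomorphic_on D \<and> (\<forall>u\<in>U. g' u = f u) \<and> w = g' z"
  then obtain g' where g': "g' holomorphic_on D" "\<And>u. u \<in> U \<Longrightarrow> g' u = f u" "w = g' z"
    by blast
  have "g' z = g z"
    by (rule analytic_continuation_open[of U D g' g]) (use assms g' in auto)
  with g' show "w = g z" by simp
qed

definition riemann_zeta :: "complex \<Rightarrow> complex" where
  "riemann_zeta = continuation {s. Re s > 1} (- {1}) (\<lambda>s. \<Sum>n. 1 / of_nat (Suc n) powr s)"

text \<open>A nonempty index list \<open>ks = [k\<^sub>1, \<dots>, k\<^sub>d]\<close> stands for \<open>Li\<close> with indices \<open>k\<^sub>1, \<dots>, k\<^sub>d\<close>;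
  the summation runs over the tuples \<open>n\<^sub>1 > \<dots> > n\<^sub>d \<ge> 1\<close>, encoded as lists of the same length.\<close>

definition mpl_series :: "nat list \<Rightarrow> complex \<Rightarrow> complex" where
  "mpl_series ks z =
     (\<Sum>\<^sub>\<infinity>ns \<in> {ns. length ns = length ks \<and> sorted_wrt (>) ns \<and> (\<forall>n\<in>set ns. n \<ge> 1)}.
        z ^ hd ns / (\<Prod>i<length ks. of_nat (ns ! i) ^ (ks ! i)))"

definition mpl :: "nat list \<Rightarrow> complex \<Rightarrow> complex" where
  "mpl ks = continuation (ball 0 1) (- (of_real ` {1..})) (mpl_series ks)"

text \<open>The Hankel contour with circle radius \<open>r\<close> and rays at heights \<open>\<plusminus>h\<close>, where \<open>0 < h < r\<close>: the ray
  from \<open>+\<infinity> + \<i>h\<close> to the circle (integrated here in the reverse direction, whence the minus sign),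
  the counterclockwise arc around 0 from \<open>sqrt (r\<^sup>2 - h\<^sup>2) + \<i>h\<close> to \<open>sqrt (r\<^sup>2 - h\<^sup>2) - \<i>h\<close>,
  and the ray back to \<open>+\<infinity> - \<i>h\<close>.\<close>

definition hankel_arc :: "real \<Rightarrow> real \<Rightarrow> real \<Rightarrow> complex" where
  "hankel_arc r h = part_circlepath 0 r (arcsin (h / r)) (2 * pi - arcsin (h / r))"

definition hankel_integrable :: "real \<Rightarrow> real \<Rightarrow> (complex \<Rightarrow> complex) \<Rightarrow> bool" where
  "hankel_integrable r h f \<longleftrightarrow>
     set_integrable lborel {sqrt (r\<^sup>2 - h\<^sup>2)..} (\<lambda>t. f (Complex t h)) \<and>
     f contour_integrable_on hankel_arc r h \<and>
     set_integrable lborel {sqrt (r\<^sup>2 - h\<^sup>2)..} (\<lambda>t. f (Complex t (- h)))"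

definition hankel_integral :: "real \<Rightarrow> real \<Rightarrow> (complex \<Rightarrow> complex) \<Rightarrow> complex" where
  "hankel_integral r h f =
     - (LINT t:{sqrt (r\<^sup>2 - h\<^sup>2)..}|lborel. f (Complex t h))
     + contour_integral (hankel_arc r h) f
     + (LINT t:{sqrt (r\<^sup>2 - h\<^sup>2)..}|lborel. f (Complex t (- h)))"

lemma hankel_arc_ends:
  assumes "0 < h" "h < r"
  shows "pathstart (hankel_arc r h) = Complex (sqrt (r\<^sup>2 - h\<^sup>2)) h"
    and "pathfinish (hankel_arc r h) = Complex (sqrt (r\<^sup>2 - h\<^sup>2)) (- h)"
proof -
  have hr: "-1 \<le> h / r" "h / r \<le> 1" "0 < r" using assms by (auto simp: field_simps)
  have "r * cos (arcsin (h / r)) = sqrt (r\<^sup>2) * sqrt (1 - (h / r)\<^sup>2)"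
    using hr by (simp add: cos_arcsin)
  also have "\<dots> = sqrt (r\<^sup>2 - h\<^sup>2)"
    using hr by (subst real_sqrt_mult[symmetric]) (simp add: power_divide right_diff_distrib)
  finally have c: "r * cos (arcsin (h / r)) = sqrt (r\<^sup>2 - h\<^sup>2)" .
  have s: "r * sin (arcsin (h / r)) = h" using hr by simp
  show "pathstart (hankel_arc r h) = Complex (sqrt (r\<^sup>2 - h\<^sup>2)) h"
    using c s unfolding hankel_arc_def by (simp add: complex_eq_iff Re_exp Im_exp)
  show "pathfinish (hankel_arc r h) = Complex (sqrt (r\<^sup>2 - h\<^sup>2)) (- h)"
    using c s unfolding hankel_arc_def
    by (simp add: complex_eq_iff Re_exp Im_exp cos_diff sin_diff del: sin_arcsin)
qed

text \<open>The contour avoids \<open>[0, \<infinity>)\<close>, so the principal branch of \<open>(- x) powr s\<close> is holomorphic along it;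
  on the upper and lower parts it has the arguments required of \<open>(-x)\<^sup>s\<close>:\<close>

lemma minus_powr_upper_lower:
  "Im x > 0 \<Longrightarrow> (- x) powr s = exp (s * (Ln x - \<i> * pi))"
  "Im x < 0 \<Longrightarrow> (- x) powr s = exp (s * (Ln x + \<i> * pi))"
proof -
  show "(- x) powr s = exp (s * (Ln x - \<i> * pi))" if "Im x > 0"
  proof -
    have "x \<noteq> 0" using that by auto
    with that show ?thesis by (simp add: powr_def Ln_minus)
  qed
  show "(- x) powr s = exp (s * (Ln x + \<i> * pi))" if "Im x < 0"
  proof -
    have "x \<noteq> 0" using that by auto
    with that show ?thesis by (simp add: powr_def Ln_minus)
  qed
qed

definition zeta_integrand :: "nat \<Rightarrow> complex \<Rightarrow> complex \<Rightarrow> complex" where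
  "zeta_integrand m s x =
     mpl (2 # replicate (m - 2) 1) (1 - exp (- x)) / x ^ m * (- x) powr s / x"

definition zeta_hankel :: "nat \<Rightarrow> real \<Rightarrow> real \<Rightarrow> complex \<Rightarrow> complex" where
  "zeta_hankel m r h s =
     - ((s - of_nat m) * Gamma (of_nat m) * Gamma (1 - s) / (2 * of_real pi * \<i>))
     * hankel_integral r h (zeta_integrand m s)"

end

theory Submission
  imports Defs
begin

text \<open>Put \<open>F(x) = Li\<^sub>2\<^sub>,\<^sub>1\<^sub>,\<^sub>\<dots>\<^sub>,\<^sub>1(1 - e\<^sup>-\<^sup>x)\<close>, of depth \<open>m - 1\<close>. The polylogarithm with \<open>m - 1\<close> indices equal to
  \<open>1\<close> is \<open>(- log (1 - z)) ^ (m - 1) / (m - 1)!\<close>, and the derivative of \<open>Li\<^sub>2\<^sub>,\<^sub>1\<^sub>,\<^sub>\<dots>\<^sub>,\<^sub>1\<close> is this function divided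
  by \<open>z\<close>. Since \<open>- log (1 - z) = x\<close> for \<open>z = 1 - e\<^sup>-\<^sup>x\<close>, the chain rule gives
  \<open>F'(x) = x ^ (m - 1) / ((m - 1)! (e\<^sup>x - 1))\<close>. Together with \<open>F(0) = 0\<close> this determines \<open>F\<close> on the strip \<open>\<bar>Im x\<bar> < \<pi>\<close>
  (\<open>mpl_2_ones_eq_primitive\<close>) and shows that it has limits along horizontal rays.

  One integration by parts on the Hankel contour moves the derivative to \<open>F\<close>. The boundary terms vanish
  for \<open>Re s < m\<close>, and the integral becomes \<open>1 / ((s - m) \<Gamma>(m))\<close> times the classical integral of
  \<open>(- x) powr (s - 1) / (e\<^sup>x - 1)\<close> (\<open>hankel_integral_zeta_integrand\<close>). The claim thereby reduces to Riemann's
  formula \<open>\<zeta>(s) = - \<Gamma>(1 - s) / (2 \<pi> \<i>)\<close> times the classical integral.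

  For \<open>Re s > 1\<close> the contour collapses onto the positive axis and leaves the Mellin transform of
  \<open>1 / (e\<^sup>t - 1)\<close>, which is \<open>\<Gamma>(s) \<zeta>(s)\<close> (\<open>hankel_integral_bose_eq_Mellin\<close>, \<open>Mellin_transform_bose\<close>). The classical
  integral is entire in \<open>s\<close> (\<open>entire_hankel_bose\<close>), so its product with \<open>\<Gamma>(1 - s)\<close>, glued with the Dirichlet
  series, is the continuation of \<open>\<zeta>\<close> (\<open>riemann_zeta_hankel\<close>). At the points \<open>2, \<dots>, m - 1\<close> the formula
  then holds as a limit by continuity of \<open>\<zeta>\<close>.\<close>

section \<open>Power series of the polylogarithms\<close>

text \<open>The inner sum of the polylogarithm series: \<open>nested_harmonic d n\<close> is the sum of
  \<open>1 / (n\<^sub>1 \<cdots> n\<^sub>d)\<close> over \<open>n > n\<^sub>1 > \<dots> > n\<^sub>d \<ge> 1\<close>.\<close>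

primrec nested_harmonic :: "nat \<Rightarrow> nat \<Rightarrow> real" where
  "nested_harmonic 0 n = 1"
| "nested_harmonic (Suc d) n = (\<Sum>k\<in>{1..<n}. nested_harmonic d k / real k)"

definition desc_tuples :: "nat \<Rightarrow> nat \<Rightarrow> nat list set" where
  "desc_tuples d n = {ns. length ns = d \<and> sorted_wrt (>) ns \<and> (\<forall>k\<in>set ns. 1 \<le> k \<and> k < n)}"

lemma nested_harmonic_nonneg: "0 \<le> nested_harmonic d n"
  by (induction d arbitrary: n) (auto intro!: sum_nonneg)

lemma nested_harmonic_le_power: "nested_harmonic d n \<le> real n ^ d"
proof (induction d arbitrary: n)
  case (Suc d)
  have "nested_harmonic (Suc d) n \<le> (\<Sum>k\<in>{1..<n}. real n ^ d)"
    unfolding nested_harmonic.simps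
  proof (rule sum_mono)
    fix k assume k: "k \<in> {1..<n}"
    have "nested_harmonic d k / real k \<le> nested_harmonic d k / 1"
      using k by (intro divide_left_mono nested_harmonic_nonneg) auto
    also have "\<dots> \<le> real k ^ d" using Suc by simp
    also have "\<dots> \<le> real n ^ d" using k by (intro power_mono) auto
    finally show "nested_harmonic d k / real k \<le> real n ^ d" .
  qed
  also have "\<dots> \<le> real n * real n ^ d" by (auto intro!: mult_right_mono)
  finally show ?case by simp
qed simp

lemma desc_tuples_0: "desc_tuples 0 n = {[]}"
  by (auto simp: desc_tuples_def)

lemma desc_tuples_Suc: "desc_tuples (Suc d) n = (\<lambda>(k, ns). k # ns) ` (SIGMA k:{1..<n}. desc_tuples d k)"
proof (intro set_eqI iffI)
  fix ns assume ns: "ns \<in> desc_tuples (Suc d) n"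
  then obtain k ks where "ns = k # ks" by (cases ns) (auto simp: desc_tuples_def)
  with ns show "ns \<in> (\<lambda>(k, ns). k # ns) ` (SIGMA k:{1..<n}. desc_tuples d k)"
    by (auto simp: desc_tuples_def image_iff)
qed (fastforce simp: desc_tuples_def)

lemma finite_desc_tuples: "finite (desc_tuples d n)"
  by (induction d arbitrary: n) (auto simp: desc_tuples_0 desc_tuples_Suc)

lemma sum_desc_tuples:
  "(\<Sum>ns\<in>desc_tuples d n. 1 / (\<Prod>i<d. real (ns ! i))) = nested_harmonic d n"
proof (induction d arbitrary: n)
  case 0
  show ?case by (simp add: desc_tuples_0)
next
  case (Suc d)
  have "(\<Sum>ns\<in>desc_tuples (Suc d) n. 1 / (\<Prod>i<Suc d. real (ns ! i))) =
      (\<Sum>(k, ns)\<in>(SIGMA k:{1..<n}. desc_tuples d k). (1 / (\<Prod>i<d. real (ns ! i))) / real k)"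
    unfolding desc_tuples_Suc
    by (subst sum.reindex) (auto simp: inj_on_def prod.lessThan_Suc_shift case_prod_unfold simp del: prod.lessThan_Suc
          intro!: sum.cong)
  also have "\<dots> = (\<Sum>k\<in>{1..<n}. \<Sum>ns\<in>desc_tuples d k. (1 / (\<Prod>i<d. real (ns ! i))) / real k)"
    by (rule sum.Sigma[symmetric]) (auto simp: finite_desc_tuples)
  also have "\<dots> = nested_harmonic (Suc d) n"
    by (simp only: nested_harmonic.simps Suc sum_divide_distrib[symmetric])
  finally show ?case .
qed

lemma summable_power_times_geometric:
  fixes x :: real
  assumes "0 \<le> x" "x < 1"
  shows "summable (\<lambda>n. real n ^ d * x ^ n)"
proof -
  define c where "c = (1 + x) / 2"
  have c: "x < c" "c < 1" using assms by (auto simp: c_def)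
  have "(\<lambda>n. (1 + inverse (real n)) ^ d * x) \<longlonglongrightarrow> (1 + 0) ^ d * x"
    by (intro tendsto_intros lim_inverse_n)
  then have "eventually (\<lambda>n. (1 + inverse (real n)) ^ d * x < c) sequentially"
    using c by (auto dest: order_tendstoD)
  with eventually_gt_at_top[of 0]
  have "eventually (\<lambda>n. (1 + inverse (real n)) ^ d * x < c \<and> n > 0) sequentially"
    by eventually_elim simp
  then obtain N where N: "\<And>n. n \<ge> N \<Longrightarrow> (1 + inverse (real n)) ^ d * x < c \<and> n > 0"
    by (auto simp: eventually_sequentially)
  show ?thesis
  proof (rule summable_ratio_test[OF c(2), of N])
    fix n assume "n \<ge> N"
    note N = N[OF this]
    have "real (Suc n) = (1 + inverse (real n)) * real n" using N by (simp add: field_simps)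
    then have "real (Suc n) ^ d * x ^ Suc n = ((1 + inverse (real n)) ^ d * x) * (real n ^ d * x ^ n)"
      by (simp only: power_mult_distrib) simp
    also have "\<dots> \<le> c * (real n ^ d * x ^ n)"
      using N assms by (intro mult_right_mono) auto
    finally show "norm (real (Suc n) ^ d * x ^ Suc n) \<le> c * norm (real n ^ d * x ^ n)"
      using assms by (simp add: abs_mult)
  qed
qed

text \<open>Grouping the tuples by their largest entry \<open>n\<close> turns the sum over tuples into an ordinary power
  series. The regrouping is legitimate because the family is absolutely summable: the inner sums are
  at most \<open>n ^ d\<close>, which the geometric factor beats.\<close>

lemma mpl_series_2_ones_sums:
  assumes z: "norm z < 1"
  shows "(\<lambda>n. of_real (nested_harmonic d n / real n ^ 2) * z ^ n) sums
           mpl_series (2 # replicate d 1) z"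
proof -
  define A where "A = (SIGMA n:{1::nat..}. desc_tuples d n)"
  define f where "f = (\<lambda>(n, ns). z ^ n / of_nat n ^ 2 * of_real (1 / (\<Prod>i<d. real (ns ! i))))"
  define S :: "nat list set"
    where "S = {ns. length ns = Suc d \<and> sorted_wrt (>) ns \<and> (\<forall>n\<in>set ns. n \<ge> 1)}"
  have inj: "inj_on (\<lambda>(k, ns). k # ns) A" by (auto simp: inj_on_def)
  have S: "S = (\<lambda>(k, ns). k # ns) ` A"
  proof (intro set_eqI iffI)
    fix ns assume ns: "ns \<in> S"
    then obtain k ks where "ns = k # ks" by (cases ns) (auto simp: S_def)
    with ns show "ns \<in> (\<lambda>(k, ns). k # ns) ` A"
      by (auto simp: desc_tuples_def image_iff A_def S_def)
  qed (fastforce simp: desc_tuples_def A_def S_def)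
  have "mpl_series (2 # replicate d 1) z =
     (\<Sum>\<^sub>\<infinity>ns\<in>S. z ^ hd ns / (\<Prod>i<Suc d. of_nat (ns ! i) ^ ((2 # replicate d 1) ! i)))"
    by (simp add: mpl_series_def S_def)
  also have "\<dots> = infsum f A"
    unfolding S
  proof (subst infsum_reindex[OF inj], rule infsum_cong)
    fix x assume "x \<in> A"
    obtain n ns where x: "x = (n, ns)" by force
    have "(\<Prod>i<d. (of_nat (ns ! i) :: complex) ^ (replicate d 1 ! i)) = of_real (\<Prod>i<d. real (ns ! i))"
      by (simp add: of_real_prod)
    then show "((\<lambda>ns. z ^ hd ns / (\<Prod>i<Suc d. of_nat (ns ! i) ^ ((2 # replicate d 1) ! i))) \<circ> (\<lambda>(k, ns). k # ns)) x = f x"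
      unfolding x o_def f_def prod.lessThan_Suc_shift by simp
  qed
  finally have eq: "mpl_series (2 # replicate d 1) z = infsum f A" .
  have inner: "(\<Sum>ns\<in>desc_tuples d n. f (n, ns)) = of_real (nested_harmonic d n / real n ^ 2) * z ^ n"
    for n
  proof -
    have "(\<Sum>ns\<in>desc_tuples d n. f (n, ns)) =
        z ^ n / of_nat n ^ 2 * of_real (\<Sum>ns\<in>desc_tuples d n. 1 / (\<Prod>i<d. real (ns ! i)))"
      by (simp only: f_def prod.case sum_distrib_left of_real_sum)
    then show ?thesis by (simp add: sum_desc_tuples)
  qed
  have inner': "(\<Sum>ns\<in>desc_tuples d n. norm (f (n, ns))) = nested_harmonic d n / real n ^ 2 * norm z ^ n"
    for n
  proof -
    have "norm (f (n, ns)) = norm z ^ n / real n ^ 2 * (1 / (\<Prod>i<d. real (ns ! i)))" for ns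
      by (simp add: f_def norm_mult norm_divide norm_power flip: of_real_prod)
         (simp add: abs_prod)
    then have "(\<Sum>ns\<in>desc_tuples d n. norm (f (n, ns))) =
        norm z ^ n / real n ^ 2 * (\<Sum>ns\<in>desc_tuples d n. 1 / (\<Prod>i<d. real (ns ! i)))"
      by (simp only: sum_distrib_left)
    then show ?thesis by (simp add: sum_desc_tuples)
  qed
  have summ: "summable (\<lambda>n. nested_harmonic d n / real n ^ 2 * norm z ^ n)"
  proof (rule summable_comparison_test'[OF summable_power_times_geometric[of "norm z" d]])
    fix n :: nat assume n: "n \<ge> 1"
    have "nested_harmonic d n / real n ^ 2 \<le> nested_harmonic d n / 1"
      using n by (intro divide_left_mono nested_harmonic_nonneg) auto
    also have "\<dots> \<le> real n ^ d" using nested_harmonic_le_power by simp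
    finally have "nested_harmonic d n / real n ^ 2 * norm z ^ n \<le> real n ^ d * norm z ^ n"
      by (intro mult_right_mono) auto
    then show "norm (nested_harmonic d n / real n ^ 2 * norm z ^ n) \<le> real n ^ d * norm z ^ n"
      using nested_harmonic_nonneg[of d n] by (simp add: abs_mult)
  qed (use z in auto)
  have "(\<lambda>x. norm (f x)) summable_on A"
    unfolding A_def
  proof (rule summable_on_SigmaI[where g = "\<lambda>n. nested_harmonic d n / real n ^ 2 * norm z ^ n"])
    fix n :: nat assume "n \<in> {1..}"
    show "((\<lambda>y. norm (f (n, y))) has_sum nested_harmonic d n / real n ^ 2 * norm z ^ n) (desc_tuples d n)"
      by (intro has_sum_finiteI finite_desc_tuples inner'[symmetric])
  next
    have "(\<lambda>n. nested_harmonic d n / real n ^ 2 * norm z ^ n) summable_on UNIV"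
      by (rule norm_summable_imp_summable_on) (use summ nested_harmonic_nonneg in \<open>simp add: abs_mult\<close>)
    then show "(\<lambda>n. nested_harmonic d n / real n ^ 2 * norm z ^ n) summable_on {1..}"
      by (rule summable_on_subset) auto
  qed auto
  then have "f summable_on A" by (rule abs_summable_summable)
  then have "(f has_sum mpl_series (2 # replicate d 1) z) (SIGMA n:{1::nat..}. desc_tuples d n)"
    unfolding eq A_def[symmetric] by (rule has_sum_infsum)
  then have "((\<lambda>n. of_real (nested_harmonic d n / real n ^ 2) * z ^ n) has_sum
      mpl_series (2 # replicate d 1) z) {1..}"
    by (rule has_sum_SigmaD) (intro has_sum_finiteI finite_desc_tuples inner[symmetric])
  also have "?this \<longleftrightarrow> ((\<lambda>n. of_real (nested_harmonic d n / real n ^ 2) * z ^ n) has_sum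
      mpl_series (2 # replicate d 1) z) UNIV"
    by (rule has_sum_cong_neutral) (auto simp: not_le)
  finally show ?thesis by (rule has_sum_imp_sums)
qed

text \<open>The Taylor coefficients at \<open>0\<close> of \<open>(- Ln (1 - z)) ^ d / fact d\<close>, the polylogarithm with all
  indices equal to \<open>1\<close>.\<close>

definition log_power_coeff :: "nat \<Rightarrow> nat \<Rightarrow> real" where
  "log_power_coeff d n =
     (case d of 0 \<Rightarrow> if n = 0 then 1 else 0 | Suc e \<Rightarrow> nested_harmonic e n / real n)"

lemma log_power_coeff_bounds: "0 \<le> log_power_coeff d n" "log_power_coeff d n \<le> real n ^ d"
proof -
  show "0 \<le> log_power_coeff d n"
    by (cases d) (auto simp: log_power_coeff_def nested_harmonic_nonneg)
  show "log_power_coeff d n \<le> real n ^ d"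
  proof (cases d)
    case (Suc e)
    show ?thesis
    proof (cases "n = 0")
      case False
      have "nested_harmonic e n / real n \<le> nested_harmonic e n / 1"
        using False by (intro divide_left_mono nested_harmonic_nonneg) auto
      also have "\<dots> \<le> real n ^ e" using nested_harmonic_le_power by simp
      also have "\<dots> \<le> real n ^ Suc e" using False by (intro power_increasing) auto
      finally show ?thesis by (simp add: log_power_coeff_def Suc)
    qed (simp add: log_power_coeff_def Suc)
  qed (simp add: log_power_coeff_def)
qed

text \<open>The recursion behind the power series of powers of the logarithm: differentiating
  \<open>(- Ln (1 - z)) ^ (d + 1) / fact (d + 1)\<close> gives \<open>(- Ln (1 - z)) ^ d / fact d\<close> times
  \<open>1 / (1 - z)\<close>, and multiplication by \<open>1 / (1 - z)\<close> replaces coefficients by their partial sums.\<close>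

lemma sum_log_power_coeff:
  "(\<Sum>k\<le>n. log_power_coeff d k) = real (Suc n) * log_power_coeff (Suc d) (Suc n)"
proof (cases d)
  case 0
  then show ?thesis by (simp add: log_power_coeff_def)
next
  case (Suc e)
  have "(\<Sum>k\<le>n. log_power_coeff d k) = (\<Sum>k\<in>{1..<Suc n}. nested_harmonic e k / real k)"
    unfolding log_power_coeff_def Suc nat.case
    by (rule sum.mono_neutral_right) (auto simp: not_less_eq_eq)
  then show ?thesis by (simp add: log_power_coeff_def Suc)
qed

lemma summable_log_power_series:
  fixes z :: complex
  assumes "norm z < 1"
  shows "summable (\<lambda>n. norm (of_real (log_power_coeff d n) * z ^ n))"
  using assms log_power_coeff_bounds
  by (intro summable_comparison_test'[OF summable_power_times_geometric[of "norm z" d], of 0])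
     (auto simp: norm_mult norm_power abs_mult intro!: mult_right_mono)

text \<open>By induction on \<open>d\<close>: both sides vanish at \<open>0\<close> and have the same derivative, by the Cauchy
  product with the geometric series and the recursion for the coefficients.\<close>

lemma log_power_series:
  assumes "norm z < 1"
  shows "(\<lambda>n. of_real (log_power_coeff d n) * z ^ n) sums ((- Ln (1 - z)) ^ d / fact d)"
  using assms
proof (induction d arbitrary: z)
  case 0
  show ?case
    using sums_single[of 0 "\<lambda>n. z ^ n"]
    by (simp add: log_power_coeff_def if_distrib if_distribR cong: if_cong)
next
  case (Suc d)
  define c :: "nat \<Rightarrow> complex" where "c = (\<lambda>n. of_real (log_power_coeff (Suc d) n))"
  define S where "S = (\<lambda>z. \<Sum>n. c n * z ^ n)"
  define P where "P = (\<lambda>z. (- Ln (1 - z)) ^ Suc d / fact (Suc d))"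
  have summ: "summable (\<lambda>n. c n * z ^ n)" if "norm z < 1" for z
    using summable_norm_cancel[OF summable_log_power_series[OF that]] by (simp add: c_def)
  have dS: "(S has_field_derivative (- Ln (1 - z)) ^ d / fact d / (1 - z)) (at z)"
    if z: "norm z < 1" for z
  proof -
    have "(\<lambda>n. \<Sum>k\<le>n. (of_real (log_power_coeff d k) * z ^ k) * z ^ (n - k)) sums
            ((\<Sum>k. of_real (log_power_coeff d k) * z ^ k) * (\<Sum>k. z ^ k))"
      using z by (intro Cauchy_product_sums summable_log_power_series)
                 (auto simp: norm_power intro!: summable_geometric)
    also have "(\<Sum>k. of_real (log_power_coeff d k) * z ^ k) = (- Ln (1 - z)) ^ d / fact d"
      using Suc.IH[OF z] by (simp add: sums_iff)
    also have "(\<Sum>k. z ^ k) = 1 / (1 - z)" using z by (rule suminf_geometric)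
    also have "(\<lambda>n. \<Sum>k\<le>n. (of_real (log_power_coeff d k) * z ^ k) * z ^ (n - k)) = (\<lambda>n. diffs c n * z ^ n)"
    proof
      fix n
      have "(\<Sum>k\<le>n. (of_real (log_power_coeff d k) * z ^ k) * z ^ (n - k)) =
              of_real (\<Sum>k\<le>n. log_power_coeff d k) * z ^ n"
        by (simp add: sum_distrib_right mult.assoc flip: power_add)
      then show "(\<Sum>k\<le>n. (of_real (log_power_coeff d k) * z ^ k) * z ^ (n - k)) = diffs c n * z ^ n"
        unfolding sum_log_power_coeff diffs_def c_def by simp
    qed
    finally have "(\<Sum>n. diffs c n * z ^ n) = (- Ln (1 - z)) ^ d / fact d / (1 - z)"
      by (simp add: sums_iff)
    with termdiffs_strong'[OF summ z] show ?thesis by (simp add: S_def)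
  qed
  have dP: "(P has_field_derivative (- Ln (1 - z)) ^ d / fact d / (1 - z)) (at z)"
    if z: "norm z < 1" for z
  proof -
    have "Re z < 1" using z complex_Re_le_cmod[of z] by linarith
    then have *: "1 - z \<notin> \<real>\<^sub>\<le>\<^sub>0" "1 - z \<noteq> 0" by (auto simp: complex_nonpos_Reals_iff)
    have "((\<lambda>z. - Ln (1 - z)) has_field_derivative 1 / (1 - z)) (at z)"
      using * by (auto intro!: derivative_eq_intros simp: inverse_eq_divide)
    from DERIV_cdivide[OF DERIV_power_Suc[OF this, of d], of "fact (Suc d)"]
    have "(P has_field_derivative (1 + of_nat d) * (1 / (1 - z) * (- Ln (1 - z)) ^ d) / fact (Suc d)) (at z)"
      unfolding P_def .
    also have "(1 + of_nat d) * (1 / (1 - z) * (- Ln (1 - z)) ^ d) / fact (Suc d) =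
        (- Ln (1 - z)) ^ d / fact d / (1 - z)"
      using of_nat_neq_0[of d, where 'a = complex] by (simp add: mult_ac)
    finally show ?thesis .
  qed
  have "\<exists>C. \<forall>z\<in>ball 0 1. S z - P z = C"
  proof (rule has_field_derivative_zero_constant)
    fix x :: complex assume "x \<in> ball 0 1"
    then have "norm x < 1" by simp
    from DERIV_diff[OF dS[OF this] dP[OF this]]
    show "((\<lambda>z. S z - P z) has_field_derivative 0) (at x within ball 0 1)"
      by (auto intro: has_field_derivative_at_within)
  qed simp
  then obtain C where C: "\<And>z. norm z < 1 \<Longrightarrow> S z - P z = C" by auto
  have "S 0 = c 0" by (simp only: S_def powser_zero)
  with C[of 0] have "C = 0" by (simp add: P_def c_def log_power_coeff_def)
  with C[OF Suc.prems] have "S z = P z" by simp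
  then show ?case using summ[OF Suc.prems] by (auto simp: sums_iff S_def P_def c_def)
qed

section \<open>The substitution \<open>z = 1 - e\<^sup>-\<^sup>x\<close>\<close>

abbreviation strip :: "complex set" where "strip \<equiv> {x. \<bar>Im x\<bar> < pi}"

lemma open_strip: "open strip" and convex_strip: "convex strip"
proof -
  have *: "strip = {x. Im x < pi} \<inter> {x. Im x > - pi}" by auto
  show "open strip" unfolding * by (intro open_Int open_halfspace_Im_lt open_halfspace_Im_gt)
  show "convex strip"
    unfolding * by (intro convex_Int convex_halfspace_Im_lt convex_halfspace_Im_gt)
qed

lemma exp_neq_1_on_strip:
  assumes "x \<in> strip" "x \<noteq> 0"
  shows "exp x \<noteq> 1"
proof
  assume "exp x = 1"
  then obtain n :: int where n: "Re x = 0" "Im x = of_int (2 * n) * pi" by (auto simp: exp_eq_1)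
  with assms have "\<bar>real_of_int (2 * n)\<bar> * pi < 1 * pi" by (simp add: abs_mult)
  then have "\<bar>real_of_int (2 * n)\<bar> < 1" by (subst (asm) mult_less_cancel_right_pos) auto
  then have "n = 0" by linarith
  with n assms show False by (simp add: complex_eq_iff)
qed

text \<open>The generating function \<open>x / (e\<^sup>x - 1)\<close> of the Bernoulli numbers with its removable singularity
  filled in. Using it instead of \<open>1 / (e\<^sup>x - 1)\<close> makes the derivative of the polylogarithm in the
  variable \<open>x\<close> holomorphic on the whole strip, \<open>0\<close> included.\<close>

definition bernoulli_gen :: "complex \<Rightarrow> complex" where
  "bernoulli_gen x = (if x = 0 then 1 else x / (exp x - 1))"

text \<open>The reciprocal is the difference quotient of \<open>exp\<close> at \<open>0\<close>, which is entire and has no zero in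
  the strip.\<close>

lemma holomorphic_bernoulli_gen: "bernoulli_gen holomorphic_on strip"
proof -
  define q :: "complex \<Rightarrow> complex"
    where "q = (\<lambda>x. if x = 0 then deriv exp 0 else (exp x - exp 0) / (x - 0))"
  have "deriv exp (0 :: complex) = 1" using DERIV_imp_deriv[OF DERIV_exp[of "0::complex"]] by simp
  then have q: "q x = (if x = 0 then 1 else (exp x - 1) / x)" for x by (simp add: q_def)
  have "q holomorphic_on strip"
    unfolding q_def by (rule pole_lemma_open[OF _ open_strip]) (auto intro!: holomorphic_intros)
  moreover have "q x \<noteq> 0" if "x \<in> strip" for x
    using exp_neq_1_on_strip[OF that] by (auto simp: q)
  ultimately have "(\<lambda>x. 1 / q x) holomorphic_on strip" by (intro holomorphic_intros) auto
  moreover have "1 / q x = bernoulli_gen x" for x by (simp add: q bernoulli_gen_def)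
  ultimately show ?thesis by simp
qed

lemma strip_primitive_exists:
  obtains F where "F 0 = 0"
    and "\<And>x. x \<in> strip \<Longrightarrow> (F has_field_derivative x ^ d / fact (Suc d) * bernoulli_gen x) (at x)"
proof -
  have "(\<lambda>x. x ^ d / fact (Suc d) * bernoulli_gen x) holomorphic_on strip"
    by (intro holomorphic_intros holomorphic_bernoulli_gen) (auto simp del: fact_Suc)
  from holomorphic_convex_primitive'[OF convex_strip open_strip this]
  obtain G where G: "\<And>x. x \<in> strip \<Longrightarrow>
      (G has_field_derivative x ^ d / fact (Suc d) * bernoulli_gen x) (at x within strip)"
    by blast
  show ?thesis
  proof (rule that[of "\<lambda>x. G x - G 0"])
    fix x assume x: "x \<in> strip"
    then have "(G has_field_derivative x ^ d / fact (Suc d) * bernoulli_gen x) (at x)"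
      using G at_within_open[OF x open_strip] by metis
    then show "((\<lambda>x. G x - G 0) has_field_derivative x ^ d / fact (Suc d) * bernoulli_gen x) (at x)"
      by (auto intro!: derivative_eq_intros)
  qed simp
qed

text \<open>The substitution \<open>z = 1 - e\<^sup>-\<^sup>x\<close> maps the strip bijectively onto the slit plane, with inverse
  \<open>x = - Ln (1 - z)\<close>. Inside the unit disc the series has derivative
  \<open>(- Ln (1 - z)) ^ (d + 1) / (fact (d + 1) * z)\<close>, and the chain rule gives the same derivative for
  \<open>F (- Ln (1 - z))\<close>. So this composition is the holomorphic extension of the series, and in the
  variable \<open>x\<close> the extension is simply \<open>F\<close>.\<close>

lemma mpl_2_ones_eq_primitive:
  assumes F0: "F 0 = 0"
    and F: "\<And>x. x \<in> strip \<Longrightarrow> (F has_field_derivative x ^ d / fact (Suc d) * bernoulli_gen x) (at x)"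
    and x: "x \<in> strip"
  shows "mpl (2 # replicate d 1) (1 - exp (- x)) = F x"
proof -
  define D :: "complex set" where "D = - (of_real ` {1..})"
  define g where "g = (\<lambda>z. F (- Ln (1 - z)))"
  have D: "z \<in> D \<longleftrightarrow> 1 - z \<notin> \<real>\<^sub>\<le>\<^sub>0" for z
  proof -
    have "z \<in> of_real ` {1..} \<longleftrightarrow> Im z = 0 \<and> Re z \<ge> 1"
      by (auto simp: complex_eq_iff image_iff intro!: bexI[of _ "Re z"])
    then show ?thesis by (auto simp: D_def complex_nonpos_Reals_iff)
  qed
  have Ln_strip: "- Ln (1 - z) \<in> strip" if "z \<in> D" for z
  proof -
    have nz: "1 - z \<notin> \<real>\<^sub>\<le>\<^sub>0" "1 - z \<noteq> 0" using that by (auto simp: D)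
    then have "Im (Ln (1 - z)) \<noteq> pi" by (simp add: Im_Ln_eq_pi complex_nonpos_Reals_iff)
    then show ?thesis using mpi_less_Im_Ln[OF nz(2)] Im_Ln_le_pi[OF nz(2)] by auto
  qed
  have g: "(g has_field_derivative
        (- Ln (1 - z)) ^ d / fact (Suc d) * bernoulli_gen (- Ln (1 - z)) * (1 / (1 - z))) (at z)"
    if "z \<in> D" for z
  proof -
    have nz: "1 - z \<notin> \<real>\<^sub>\<le>\<^sub>0" "1 - z \<noteq> 0" using that by (auto simp: D)
    have "((\<lambda>z. - Ln (1 - z)) has_field_derivative 1 / (1 - z)) (at z)"
      using nz by (auto intro!: derivative_eq_intros simp: inverse_eq_divide)
    from DERIV_chain[OF F[OF Ln_strip[OF that]] this] show ?thesis
      by (simp add: g_def o_def)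
  qed
  have ball_D: "z \<in> D" if "norm z < 1" for z
    using that complex_Re_le_cmod[of z] by (auto simp: D complex_nonpos_Reals_iff)
  have g_series: "g z = mpl_series (2 # replicate d 1) z" if z: "norm z < 1" for z
  proof -
    define c :: "nat \<Rightarrow> complex" where "c = (\<lambda>n. of_real (nested_harmonic d n / real n ^ 2))"
    define S where "S = (\<lambda>z. \<Sum>n. c n * z ^ n)"
    have summ: "summable (\<lambda>n. c n * z ^ n)" if "norm z < 1" for z
      using mpl_series_2_ones_sums[OF that, of d] by (auto simp: c_def sums_iff)
    have S': "(S has_field_derivative (\<Sum>n. diffs c n * z ^ n)) (at z)" if "norm z < 1" for z
      unfolding S_def by (rule termdiffs_strong'[OF summ that])
    have "\<exists>C. \<forall>z\<in>ball 0 1. S z - g z = C"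
    \<comment> \<open>The formula for the common derivative divides by \<open>z\<close>, so the point \<open>0\<close> is excepted.\<close>
    proof (rule DERIV_zero_connected_constant[of "ball 0 1" "{0}" "\<lambda>z. S z - g z"])
      show "continuous_on (ball 0 1) (\<lambda>z. S z - g z)"
        using S' g ball_D
        by (intro continuous_on_diff continuous_at_imp_continuous_on ballI)
           (auto intro!: DERIV_isCont)
    next
      show "\<forall>z\<in>ball 0 1 - {0}. DERIV (\<lambda>z. S z - g z) z :> 0"
      proof
        fix z :: complex assume "z \<in> ball 0 1 - {0}"
        then have z: "norm z < 1" "z \<noteq> 0" by auto
        have z1: "1 - z \<noteq> 0" using z by auto
        have "(\<lambda>n. of_real (log_power_coeff (Suc d) n) * z ^ n) sums ((- Ln (1 - z)) ^ Suc d / fact (Suc d))"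
          by (rule log_power_series[OF z(1)])
        moreover have "log_power_coeff (Suc d) 0 = 0" by (simp add: log_power_coeff_def)
        ultimately have "(\<lambda>n. of_real (log_power_coeff (Suc d) (Suc n)) * z ^ Suc n) sums
            ((- Ln (1 - z)) ^ Suc d / fact (Suc d))"
          by (subst sums_Suc_iff) simp
        then have "(\<lambda>n. of_real (log_power_coeff (Suc d) (Suc n)) * z ^ Suc n / z) sums
            ((- Ln (1 - z)) ^ Suc d / fact (Suc d) / z)"
          by (rule sums_divide)
        also have "(\<lambda>n. of_real (log_power_coeff (Suc d) (Suc n)) * z ^ Suc n / z) = (\<lambda>n. diffs c n * z ^ n)"
        proof
          fix n
          have "of_real (log_power_coeff (Suc d) (Suc n)) = diffs c n"
          proof -
            have "log_power_coeff (Suc d) (Suc n) =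
                real (Suc n) * (nested_harmonic d (Suc n) / real (Suc n) ^ 2)"
              unfolding log_power_coeff_def nat.case by (simp only: power2_eq_square) simp
            then show ?thesis by (simp only: diffs_def c_def of_real_mult of_real_of_nat_eq)
          qed
          then show "of_real (log_power_coeff (Suc d) (Suc n)) * z ^ Suc n / z = diffs c n * z ^ n"
            using z by simp
        qed
        finally have "(\<Sum>n. diffs c n * z ^ n) = (- Ln (1 - z)) ^ Suc d / fact (Suc d) / z"
          by (rule sums_unique[symmetric])
        also have "\<dots> = (- Ln (1 - z)) ^ d / fact (Suc d) * bernoulli_gen (- Ln (1 - z)) * (1 / (1 - z))"
        proof -
          have "exp (- Ln (1 - z)) = 1 / (1 - z)"
            using z1 by (simp add: exp_minus inverse_eq_divide)
          moreover have "Ln (1 - z) \<noteq> 0" using z exp_Ln[OF z1] by auto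
          ultimately have "bernoulli_gen (- Ln (1 - z)) = - Ln (1 - z) / (z / (1 - z))"
            using z1 by (simp add: bernoulli_gen_def diff_divide_distrib[symmetric] divide_diff_eq_iff)
          then show ?thesis using z1 by (simp del: fact_Suc)
        qed
        finally show "DERIV (\<lambda>z. S z - g z) z :> 0"
          using DERIV_diff[OF S'[OF z(1)] g[OF ball_D[OF z(1)]]] by simp
      qed
    qed auto
    then obtain C where C: "\<And>z. norm z < 1 \<Longrightarrow> S z - g z = C" by auto
    have "S 0 = c 0" by (simp only: S_def powser_zero)
    with C[of 0] F0 have "C = 0" by (simp add: g_def c_def)
    with C[OF z] have "S z = g z" by simp
    then show ?thesis
      using mpl_series_2_ones_sums[OF z, of d] by (simp add: S_def c_def sums_iff)
  qed
  have "closed_segment 0 z \<subseteq> D" if z: "z \<in> D" for z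
  proof
    fix w assume "w \<in> closed_segment 0 z"
    then obtain u where u: "0 \<le> u" "u \<le> 1" "w = of_real u * z"
      by (auto simp: closed_segment_def scaleR_conv_of_real)
    show "w \<in> D"
    proof (rule ccontr)
      assume "w \<notin> D"
      then have w: "u * Re z \<ge> 1" "u * Im z = 0" by (auto simp: D complex_nonpos_Reals_iff u)
      then have "u \<noteq> 0" by auto
      moreover have "Re z \<ge> 1" 
      proof -
        have "Re z > 0" using w u by (smt (verit) mult_nonneg_nonpos)
        then have "u * Re z \<le> Re z" using u by (simp add: mult_left_le_one_le)
        with w show ?thesis by simp
      qed
      ultimately show False using z w by (simp add: D complex_nonpos_Reals_iff)
    qed
  qed
  then have "starlike D" using ball_D[of 0] unfolding starlike_def by auto
  have "open D"
  proof -
    have "D = (\<lambda>z. 1 - z) -` (- \<real>\<^sub>\<le>\<^sub>0)" using D by auto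
    then show ?thesis
      by (simp add: open_vimage continuous_on_diff open_Compl closed_nonpos_Reals_complex)
  qed
  have xD: "1 - exp (- x) \<in> D" and Ln_x: "Ln (exp (- x)) = - x"
  proof -
    show "Ln (exp (- x)) = - x" using x by (subst Ln_exp) auto
    have "exp (- x) \<notin> \<real>\<^sub>\<le>\<^sub>0"
    proof
      assume "exp (- x) \<in> \<real>\<^sub>\<le>\<^sub>0"
      then have "Re (exp (- x)) \<le> 0" "Im (exp (- x)) = 0" by (auto simp: complex_nonpos_Reals_iff)
      moreover from this have "Re (exp (- x)) \<noteq> 0"
        using exp_not_eq_zero[of "- x"] by (metis complex_eq_iff zero_complex.sel)
      ultimately have "Im (Ln (exp (- x))) = pi"
        by (subst Im_Ln_eq_pi) (auto simp: less_le simp del: Re_exp Im_exp)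
      with x show False by (subst (asm) Ln_exp) auto
    qed
    then show "1 - exp (- x) \<in> D" by (simp add: D)
  qed
  have "continuation (ball 0 1) D (mpl_series (2 # replicate d 1)) (1 - exp (- x)) = g (1 - exp (- x))"
  proof (rule continuation_eqI)
    show "g holomorphic_on D"
      using g \<open>open D\<close> by (intro holomorphic_onI) (auto simp: field_differentiable_def intro: has_field_derivative_at_within)
  qed (use \<open>open D\<close> \<open>starlike D\<close> xD ball_D g_series starlike_imp_connected in auto)
  then show ?thesis by (simp add: mpl_def D_def g_def Ln_x)
qed

section \<open>Exponential integrals and decay along rays\<close>

text \<open>Expanding \<open>exp (s * l t)\<close> in powers of \<open>s\<close> and integrating term by term represents the integral by
  a power series in \<open>s\<close> that converges everywhere. The exponential moment condition on \<open>l\<close> dominates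
  all partial sums at once. Each piece of the Hankel integral has this form, with \<open>l\<close> the logarithm
  of \<open>- x\<close>.\<close>

lemma entire_integral_exp:
  fixes w l :: "'a \<Rightarrow> complex"
  assumes [measurable]: "w \<in> borel_measurable M" "l \<in> borel_measurable M"
    and int: "\<And>R. R \<ge> 0 \<Longrightarrow> integrable M (\<lambda>t. norm (w t) * exp (R * norm (l t)))"
  shows "integrable M (\<lambda>t. w t * exp (s * l t))"
    and "(\<lambda>s. \<integral>t. w t * exp (s * l t) \<partial>M) holomorphic_on UNIV"
proof -
  show "integrable M (\<lambda>t. w t * exp (s * l t))"
  proof (rule Bochner_Integration.integrable_bound[OF int[of "norm s"]])
    show "AE t in M. norm (w t * exp (s * l t)) \<le> norm (norm (w t) * exp (norm s * norm (l t)))"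
    proof (intro always_eventually allI)
      fix t
      have "norm (w t * exp (s * l t)) = norm (w t) * norm (exp (s * l t))" by (rule norm_mult)
      also have "\<dots> \<le> norm (w t) * exp (norm (s * l t))"
        by (intro mult_left_mono norm_exp norm_ge_zero)
      finally show "norm (w t * exp (s * l t)) \<le> norm (norm (w t) * exp (norm s * norm (l t)))"
        by (simp only: norm_mult) simp
    qed
  qed auto
  define f where "f = (\<lambda>s k t. w t * (s * l t) ^ k / fact k)"
  define a where "a = (\<lambda>k. \<integral>t. w t * l t ^ k / fact k \<partial>M)"
  have nf: "norm (f s k t) = norm (w t) * ((norm s * norm (l t)) ^ k / fact k)" for s k t
    by (simp add: f_def norm_mult norm_divide norm_power)
  have partial: "(\<Sum>k<n. norm (f s k t)) \<le> norm (w t) * exp (norm s * norm (l t))" for s n t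
  proof -
    have "(\<Sum>k<n. (norm s * norm (l t)) ^ k / fact k) \<le> (\<Sum>k. (norm s * norm (l t)) ^ k / fact k)"
      using summable_exp[of "norm s * norm (l t)"]
      by (intro sum_le_suminf) (auto simp: divide_inverse mult.commute)
    also have "\<dots> = exp (norm s * norm (l t))"
      by (simp add: exp_def divide_inverse mult.commute)
    finally show ?thesis
      unfolding nf sum_distrib_left[symmetric] by (intro mult_left_mono norm_ge_zero)
  qed
  have f_int: "integrable M (f s k)" for s k
  proof (rule Bochner_Integration.integrable_bound[OF int[of "norm s"]])
    show "AE t in M. norm (f s k t) \<le> norm (norm (w t) * exp (norm s * norm (l t)))"
    proof (intro always_eventually allI)
      fix t
      have "norm (f s k t) \<le> (\<Sum>k<Suc k. norm (f s k t))"
        by (intro member_le_sum) auto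
      also have "\<dots> \<le> norm (w t) * exp (norm s * norm (l t))" by (rule partial)
      finally show "norm (f s k t) \<le> norm (norm (w t) * exp (norm s * norm (l t)))" by simp
    qed
  qed (auto simp: f_def)
  have "(\<lambda>k. a k * s ^ k) sums (\<integral>t. w t * exp (s * l t) \<partial>M)" for s
  proof -
    have "(\<lambda>k. \<integral>t. f s k t \<partial>M) sums (\<integral>t. (\<Sum>k. f s k t) \<partial>M)"
    proof (rule sums_integral[OF f_int])
      show "AE t in M. summable (\<lambda>k. norm (f s k t))"
        by (intro always_eventually allI summableI_nonneg_bounded[OF _ partial]) auto
      show "summable (\<lambda>k. \<integral>t. norm (f s k t) \<partial>M)"
      proof (rule summableI_nonneg_bounded)
        fix n
        have "(\<Sum>k<n. \<integral>t. norm (f s k t) \<partial>M) = (\<integral>t. (\<Sum>k<n. norm (f s k t)) \<partial>M)"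
          by (rule Bochner_Integration.integral_sum[symmetric]) (intro integrable_norm f_int)
        also have "\<dots> \<le> (\<integral>t. norm (w t) * exp (norm s * norm (l t)) \<partial>M)"
          by (intro integral_mono partial int Bochner_Integration.integrable_sum integrable_norm f_int) auto
        finally show "(\<Sum>k<n. \<integral>t. norm (f s k t) \<partial>M) \<le>
            (\<integral>t. norm (w t) * exp (norm s * norm (l t)) \<partial>M)" .
      qed auto
    qed
    also have "(\<lambda>t. \<Sum>k. f s k t) = (\<lambda>t. w t * exp (s * l t))"
    proof
      fix t
      have "(\<lambda>k. w t * ((s * l t) ^ k /\<^sub>R fact k)) sums (w t * exp (s * l t))"
        by (intro sums_mult exp_converges)
      then show "(\<Sum>k. f s k t) = w t * exp (s * l t)"
        by (simp add: sums_iff f_def scaleR_conv_of_real divide_inverse mult_ac)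
    qed
    also have "(\<lambda>k. \<integral>t. f s k t \<partial>M) = (\<lambda>k. a k * s ^ k)"
    proof
      fix k
      have "f s k = (\<lambda>t. (w t * l t ^ k / fact k) * s ^ k)"
        by (auto simp: f_def power_mult_distrib)
      then show "(\<integral>t. f s k t \<partial>M) = a k * s ^ k" by (simp add: a_def)
    qed
    finally show ?thesis .
  qed
  then have "(\<lambda>s. \<integral>t. w t * exp (s * l t) \<partial>M) holomorphic_on ball 0 R" for R
    by (intro power_series_holomorphic[where a = a]) auto
  then have "(\<lambda>s. \<integral>t. w t * exp (s * l t) \<partial>M) field_differentiable at s" for s
    by (rule holomorphic_on_imp_differentiable_at[of _ "ball 0 (norm s + 1)"]) auto
  then show "(\<lambda>s. \<integral>t. w t * exp (s * l t) \<partial>M) holomorphic_on UNIV"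
    by (simp add: holomorphic_on_def field_differentiable_at_within)
qed

lemma entire_set_integral_exp:
  fixes w l :: "real \<Rightarrow> complex"
  assumes A: "A \<in> sets borel" and w: "continuous_on A w" and l: "continuous_on A l"
    and int: "\<And>R. R \<ge> 0 \<Longrightarrow> set_integrable lborel A (\<lambda>t. norm (w t) * exp (R * norm (l t)))"
  shows "set_integrable lborel A (\<lambda>t. w t * exp (s * l t))"
    and "(\<lambda>s. LINT t:A|lborel. w t * exp (s * l t)) holomorphic_on UNIV"
proof -
  let ?M = "restrict_space lborel A"
  have A': "A \<inter> space lborel \<in> sets lborel" using A by simp
  have sets_M: "sets ?M = sets (restrict_space borel A)" by (simp add: sets_restrict_space)
  have m: "w \<in> borel_measurable ?M" "l \<in> borel_measurable ?M"
    using borel_measurable_continuous_on_restrict[OF w] borel_measurable_continuous_on_restrict[OF l]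
    by (simp_all add: measurable_cong_sets[OF sets_M refl])
  have i: "\<And>R. R \<ge> 0 \<Longrightarrow> integrable ?M (\<lambda>t. norm (w t) * exp (R * norm (l t)))"
    using int by (simp add: integrable_restrict_space[OF A'] set_integrable_def)
  from entire_integral_exp[OF m i]
  show "set_integrable lborel A (\<lambda>t. w t * exp (s * l t))"
    and "(\<lambda>s. LINT t:A|lborel. w t * exp (s * l t)) holomorphic_on UNIV"
    by (simp_all add: integrable_restrict_space[OF A'] integral_restrict_space[OF A']
        set_integrable_def set_lebesgue_integral_def)
qed

lemma set_integrable_Ici_dominated:
  fixes f :: "real \<Rightarrow> 'a :: {banach, second_countable_topology}" and g :: "real \<Rightarrow> real"
  assumes f: "continuous_on {a..} f" and g: "set_integrable lborel {a..} g"
    and le: "\<And>t. t \<ge> a \<Longrightarrow> norm (f t) \<le> g t"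
  shows "set_integrable lborel {a..} f"
proof (rule set_integrable_bound[OF g])
  show "set_borel_measurable lborel {a..} f"
    using borel_measurable_continuous_on_indicator[OF _ f] by (simp add: set_borel_measurable_def)
  show "AE t in lborel. t \<in> {a..} \<longrightarrow> norm (f t) \<le> norm (g t)"
    using le by (intro always_eventually) (smt (verit) atLeast_iff norm_ge_zero real_norm_def)
qed

lemma set_integrable_lborel_nonneg:
  fixes g :: "real \<Rightarrow> real"
  assumes A: "A \<in> sets borel" and g: "continuous_on A g" "g integrable_on A"
    and nonneg: "\<And>t. t \<in> A \<Longrightarrow> 0 \<le> g t"
  shows "set_integrable lborel A g"
proof -
  have "set_integrable lebesgue A g"
    by (rule nonnegative_absolutely_integrable_1[OF g(2) nonneg])
  moreover have "set_borel_measurable lborel A g"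
    using borel_measurable_continuous_on_indicator[OF A g(1)] by (simp add: set_borel_measurable_def)
  ultimately show ?thesis
    by (simp add: set_integrable_def set_borel_measurable_def integrable_completion)
qed

lemma set_integrable_exp_decay:
  assumes "0 < (c::real)" shows "set_integrable lborel {a..} (\<lambda>t. exp (- c * t))"
  using has_integral_exp_minus_to_infinity[OF assms, of a]
  by (intro set_integrable_lborel_nonneg) (auto intro!: continuous_intros simp: has_integral_integrable)

lemma set_integrable_powr_decay:
  assumes "e < -1" "0 < (a::real)" shows "set_integrable lborel {a..} (\<lambda>t. t powr e)"
  using has_integral_powr_to_inf[OF assms] assms
  by (intro set_integrable_lborel_nonneg) (auto intro!: continuous_intros simp: has_integral_integrable)

text \<open>Since \<open>ln y\<close> grows more slowly than any multiple of \<open>y\<close>, any power of \<open>norm x\<close> and any constant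
  multiple of the argument are absorbed by half of the exponential decay of \<open>1 / (e\<^sup>x - 1)\<close>. The next
  lemmas carry this estimate over to the complex logarithm.\<close>

lemma abs_ln_sublinear:
  assumes "(a::real) > 0" "R \<ge> 0"
  obtains K where "\<And>y. y \<ge> a \<Longrightarrow> R * \<bar>ln y\<bar> \<le> y / 2 + K"
proof
  fix y assume y: "y \<ge> a"
  define Q where "Q = R + 1"
  have Q: "Q > 0" "R \<le> Q" using assms by (auto simp: Q_def)
  have "Q * \<bar>ln y\<bar> \<le> y / 2 + (Q * \<bar>ln (2 * Q)\<bar> + Q * \<bar>ln a\<bar>)"
  proof (cases "y \<ge> 1")
    case True
    \<comment> \<open>The bound \<open>ln u \<le> u - 1\<close> at \<open>u = y / (2 * Q)\<close> becomes \<open>y / 2 - Q\<close> after multiplication by \<open>Q\<close>.\<close>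
    have "ln y = ln (y / (2 * Q)) + ln (2 * Q)" using Q True by (simp add: ln_div)
    also have "\<dots> \<le> (y / (2 * Q) - 1) + \<bar>ln (2 * Q)\<bar>"
      using Q True by (intro add_mono ln_le_minus_one) auto
    finally have "Q * ln y \<le> Q * ((y / (2 * Q) - 1) + \<bar>ln (2 * Q)\<bar>)" using Q by simp
    also have "\<dots> = y / 2 - Q + Q * \<bar>ln (2 * Q)\<bar>" using Q by (simp add: field_simps)
    finally have "Q * ln y \<le> y / 2 - Q + Q * \<bar>ln (2 * Q)\<bar>" .
    moreover have "0 \<le> Q * \<bar>ln a\<bar>" using Q by simp
    ultimately show ?thesis using True Q ln_ge_zero[OF True] abs_of_nonneg[OF ln_ge_zero[OF True]] by linarith
  next
    case False
    have "ln a \<le> ln y" "ln y < 0" using assms y False by auto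
    then have "Q * \<bar>ln y\<bar> \<le> Q * \<bar>ln a\<bar>" using Q by (intro mult_left_mono) auto
    moreover have "0 \<le> Q * \<bar>ln (2 * Q)\<bar>" using Q by simp
    ultimately show ?thesis using y assms by linarith
  qed
  moreover have "R * \<bar>ln y\<bar> \<le> Q * \<bar>ln y\<bar>" using Q by (intro mult_right_mono) auto
  ultimately show "R * \<bar>ln y\<bar> \<le> y / 2 + ((R + 1) * \<bar>ln (2 * (R + 1))\<bar> + (R + 1) * \<bar>ln a\<bar>)"
    by (simp add: Q_def)
qed

lemma norm_Ln_sublinear:
  assumes "a > 0" "R \<ge> 0"
  obtains K where "\<And>x. Re x \<ge> a \<Longrightarrow> \<bar>Im x\<bar> \<le> pi \<Longrightarrow>
      R * norm (Ln x) \<le> Re x / 2 + K \<and> R * norm (Ln (- x)) \<le> Re x / 2 + K"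
proof -
  obtain K where K: "\<And>y. y \<ge> a \<Longrightarrow> R * \<bar>ln y\<bar> \<le> y / 2 + K"
    using abs_ln_sublinear[OF assms] by metis
  show ?thesis
  proof (rule that[of "pi / 2 + K + R * pi"])
    fix x assume x: "Re x \<ge> a" "\<bar>Im x\<bar> \<le> pi"
    then have nz: "x \<noteq> 0" using assms by auto
    have le: "norm (Ln w) \<le> \<bar>ln (norm x)\<bar> + pi" if "norm w = norm x" for w
    proof -
      have "w \<noteq> 0" using that nz by auto
      then have "norm (Ln w) \<le> \<bar>ln (norm w)\<bar> + \<bar>Im (Ln w)\<bar>" using cmod_le[of "Ln w"] by simp
      also have "\<bar>Im (Ln w)\<bar> \<le> pi"
        using mpi_less_Im_Ln[OF \<open>w \<noteq> 0\<close>] Im_Ln_le_pi[OF \<open>w \<noteq> 0\<close>] by auto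
      finally show ?thesis using that by simp
    qed
    have "R * norm (Ln w) \<le> Re x / 2 + (pi / 2 + K + R * pi)" if "norm w = norm x" for w
    proof -
      have "R * norm (Ln w) \<le> R * \<bar>ln (norm x)\<bar> + R * pi"
        using le[OF that] assms by (metis distrib_left mult_left_mono)
      also have "R * \<bar>ln (norm x)\<bar> \<le> norm x / 2 + K"
        using x complex_Re_le_cmod[of x] by (intro K) linarith
      also have "norm x \<le> Re x + pi" using cmod_le[of x] x assms by auto
      finally show ?thesis by (simp add: field_simps)
    qed
    then show "R * norm (Ln x) \<le> Re x / 2 + (pi / 2 + K + R * pi) \<and>
        R * norm (Ln (- x)) \<le> Re x / 2 + (pi / 2 + K + R * pi)" by simp
  qed
qed

lemma norm_exp_minus_1_ge:
  assumes "Re x \<ge> a"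
  shows "norm (exp x - 1) \<ge> (1 - exp (- a)) * exp (Re x)"
proof -
  have "1 \<le> exp (- a) * exp (Re x)" using assms by (simp flip: exp_add)
  then have "(1 - exp (- a)) * exp (Re x) \<le> norm (exp x) - norm (1::complex)"
    by (simp add: algebra_simps)
  also have "\<dots> \<le> norm (exp x - 1)" by (rule norm_triangle_ineq2)
  finally show ?thesis .
qed

lemma exp_Ln_over_exp_minus_1_decay:
  assumes "a > 0" "R \<ge> 0"
  obtains C where "C \<ge> 0"
    and "\<And>x. Re x \<ge> a \<Longrightarrow> \<bar>Im x\<bar> \<le> pi \<Longrightarrow> exp (R * norm (Ln x)) / norm (exp x - 1) \<le> C * exp (- (1/2) * Re x)"
    and "\<And>x. Re x \<ge> a \<Longrightarrow> \<bar>Im x\<bar> \<le> pi \<Longrightarrow> exp (R * norm (Ln (- x))) / norm (exp x - 1) \<le> C * exp (- (1/2) * Re x)"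
proof -
  obtain K where K: "\<And>x. Re x \<ge> a \<Longrightarrow> \<bar>Im x\<bar> \<le> pi \<Longrightarrow>
      R * norm (Ln x) \<le> Re x / 2 + K \<and> R * norm (Ln (- x)) \<le> Re x / 2 + K"
    using norm_Ln_sublinear[OF assms] by metis
  define C where "C = exp K / (1 - exp (- a))"
  have q: "1 - exp (- a) > 0" using assms by simp
  have main: "exp L / norm (exp x - 1) \<le> C * exp (- (1/2) * Re x)"
    if "Re x \<ge> a" "L \<le> Re x / 2 + K" for x :: complex and L
  proof -
    have "exp L / norm (exp x - 1) \<le> exp (Re x / 2 + K) / ((1 - exp (- a)) * exp (Re x))"
      using that norm_exp_minus_1_ge[OF that(1)] q by (intro frac_le) auto
    also have "exp (Re x / 2 + K) = exp K * exp (- (1/2) * Re x) * exp (Re x)"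
      by (simp flip: exp_add)
    finally show ?thesis by (simp add: C_def)
  qed
  show ?thesis
    by (rule that[of C]) (use main K q in \<open>auto simp: C_def\<close>)
qed

section \<open>The classical Hankel integral\<close>

text \<open>The Hankel contour lies in this starlike domain, on which \<open>(- x) powr s\<close> and
  \<open>1 / (e\<^sup>x - 1)\<close> are holomorphic.\<close>

definition slit_strip :: "complex set" where
  "slit_strip = strip - \<real>\<^sub>\<ge>\<^sub>0"

lemma slit_stripD:
  assumes "x \<in> slit_strip"
  shows "x \<in> strip" "x \<noteq> 0" "- x \<notin> \<real>\<^sub>\<le>\<^sub>0" "exp x - 1 \<noteq> 0"
proof -
  show x: "x \<in> strip" "x \<noteq> 0" "- x \<notin> \<real>\<^sub>\<le>\<^sub>0" using assms by (auto simp: slit_strip_def)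
  show "exp x - 1 \<noteq> 0" using exp_neq_1_on_strip[OF x(1,2)] by simp
qed

lemma open_slit_strip: "open slit_strip"
  unfolding slit_strip_def by (intro open_Diff open_strip closed_nonneg_Reals_complex)

text \<open>Every point of the domain is seen from \<open>- 1\<close>: a segment that starts there can meet the
  nonnegative axis only if its other end lies on it.\<close>

lemma starlike_slit_strip: "starlike slit_strip"
proof -
  have "closed_segment (- 1) x \<subseteq> slit_strip" if x: "x \<in> slit_strip" for x
  proof
    fix y assume "y \<in> closed_segment (- 1) x"
    then obtain u where u: "0 \<le> u" "u \<le> 1" "y = of_real u * x - of_real (1 - u)"
      by (auto simp: closed_segment_def scaleR_conv_of_real)
    have "\<bar>Im y\<bar> = u * \<bar>Im x\<bar>" using u by (simp add: abs_mult)
    also have "\<dots> \<le> \<bar>Im x\<bar>" using u by (simp add: mult_left_le_one_le)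
    also have "\<dots> < pi" using x by (simp add: slit_strip_def)
    finally have "\<bar>Im y\<bar> < pi" .
    moreover have "y \<notin> \<real>\<^sub>\<ge>\<^sub>0"
    proof
      assume "y \<in> \<real>\<^sub>\<ge>\<^sub>0"
      then have y: "u * Im x = 0" "u * Re x \<ge> 1 - u"
        by (auto simp: u complex_nonneg_Reals_iff)
      then have "u \<noteq> 0" by auto
      with y u have "Im x = 0" "u * Re x \<ge> 0" by auto
      with \<open>u \<noteq> 0\<close> u have "Im x = 0" "Re x \<ge> 0" by (auto simp: zero_le_mult_iff)
      with x show False by (auto simp: slit_strip_def complex_nonneg_Reals_iff)
    qed
    ultimately show "y \<in> slit_strip" by (simp add: slit_strip_def)
  qed
  moreover have "- 1 \<in> slit_strip" by (simp add: slit_strip_def complex_nonneg_Reals_iff)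
  ultimately show ?thesis unfolding starlike_def by blast
qed

lemma ray_in_slit_strip: "y \<noteq> 0 \<Longrightarrow> \<bar>y\<bar> < pi \<Longrightarrow> Complex t y \<in> slit_strip"
  by (auto simp: slit_strip_def complex_nonneg_Reals_iff)

lemma arc_angle_bounds:
  assumes "0 < h" "h < r"
  shows "0 < arcsin (h / r)" "arcsin (h / r) < pi / 2"
proof -
  have "0 < h / r" "h / r < 1" using assms by auto
  then show "0 < arcsin (h / r)" "arcsin (h / r) < pi / 2"
    using arcsin_less_mono[of 0 "h / r"] arcsin_less_mono[of "h / r" 1] by auto
qed

lemma arc_in_slit_strip:
  assumes "0 < r" "r < pi" "0 < \<theta>" "\<theta> < 2 * pi"
  shows "of_real r * cis \<theta> \<in> slit_strip"
proof -
  have "\<bar>Im (of_real r * cis \<theta>)\<bar> \<le> norm (of_real r * cis \<theta>)" by (rule abs_Im_le_cmod)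
  also have "\<dots> = r" using assms by (simp add: norm_mult)
  finally have "\<bar>Im (of_real r * cis \<theta>)\<bar> < pi" using assms by simp
  moreover have "of_real r * cis \<theta> \<notin> \<real>\<^sub>\<ge>\<^sub>0"
  proof
    assume "of_real r * cis \<theta> \<in> \<real>\<^sub>\<ge>\<^sub>0"
    then have s: "sin \<theta> = 0" and c: "cos \<theta> \<ge> 0"
      using assms by (auto simp: complex_nonneg_Reals_iff zero_le_mult_iff)
    from s c have "cos \<theta> = 1" using sin_cos_squared_add[of \<theta>] by (simp add: power2_eq_1_iff) 
    then obtain n :: int where n: "\<theta> = of_int n * (2 * pi)" by (auto simp: cos_one_2pi_int)
    with assms have "0 < real_of_int n" "real_of_int n < 1" by (auto simp: zero_less_mult_iff)
    then show False by simp
  qed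
  ultimately show ?thesis by (simp add: slit_strip_def)
qed

lemma path_image_hankel_arc:
  assumes "0 < h" "h < r" "r < pi"
  shows "path_image (hankel_arc r h) \<subseteq> slit_strip"
    and "x \<in> path_image (hankel_arc r h) \<Longrightarrow> norm x = r"
proof -
  have \<theta>: "arcsin (h / r) \<le> 2 * pi - arcsin (h / r)"
    using arc_angle_bounds[OF assms(1,2)] by linarith
  have *: "\<exists>\<theta>. 0 < \<theta> \<and> \<theta> < 2 * pi \<and> x = of_real r * cis \<theta>" if x: "x \<in> path_image (hankel_arc r h)" for x
  proof -
    obtain \<theta> where "x = of_real r * cis \<theta>" "arcsin (h / r) \<le> \<theta>" "\<theta> \<le> 2 * pi - arcsin (h / r)"
      using x unfolding hankel_arc_def path_image_part_circlepath[OF \<theta>] cis_conv_exp[symmetric]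
      by auto
    then show ?thesis using arc_angle_bounds[OF assms(1,2)] by (intro exI[of _ \<theta>]) auto
  qed
  show "path_image (hankel_arc r h) \<subseteq> slit_strip"
    using * arc_in_slit_strip assms by fastforce
  show "norm x = r" if "x \<in> path_image (hankel_arc r h)"
    using *[OF that] assms by (auto simp: norm_mult)
qed

text \<open>The integrand of the classical Hankel integral for \<open>\<zeta>(s)\<close>.\<close>

definition bose_integrand :: "complex \<Rightarrow> complex \<Rightarrow> complex" where
  "bose_integrand s x = (- x) powr (s - 1) / (exp x - 1)"

lemma bose_integrand_eq_exp:
  assumes "x \<noteq> 0"
  shows "bose_integrand s x = 1 / (- x * (exp x - 1)) * exp (s * Ln (- x))"
proof -
  have "(- x) powr (s - 1) = exp (s * Ln (- x)) / exp (Ln (- x))"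
    using assms by (simp add: powr_def exp_diff left_diff_distrib)
  then show ?thesis using assms by (simp add: bose_integrand_def)
qed

lemma holomorphic_bose_integrand: "bose_integrand s holomorphic_on slit_strip"
  unfolding bose_integrand_def using slit_stripD by (intro holomorphic_intros) auto

lemma bose_integrand_primitive:
  obtains A where "\<And>x. x \<in> slit_strip \<Longrightarrow> (A has_field_derivative bose_integrand s x) (at x)"
proof -
  have "\<exists>A. \<forall>x\<in>slit_strip. (A has_field_derivative bose_integrand s x) (at x)"
    using holomorphic_bose_integrand[of s]
    by (intro holomorphic_starlike_primitive[where k = "{}"] starlike_slit_strip open_slit_strip)
       (auto intro: holomorphic_on_imp_continuous_on holomorphic_on_imp_differentiable_at open_slit_strip)
  then show ?thesis using that by blast
qed

lemma continuous_on_Complex_line: "continuous_on A (\<lambda>t. Complex t y)"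
  unfolding Complex_eq by (intro continuous_intros)

lemma bose_integrand_ray:
  assumes "a > 0" "y \<noteq> 0" "\<bar>y\<bar> < pi"
  shows "set_integrable lborel {a..} (\<lambda>t. bose_integrand s (Complex t y))"
    and "(\<lambda>s. LINT t:{a..}|lborel. bose_integrand s (Complex t y)) holomorphic_on UNIV"
proof -
  define w where "w = (\<lambda>t. 1 / (- Complex t y * (exp (Complex t y) - 1)))"
  define l where "l = (\<lambda>t. Ln (- Complex t y))"
  note D = slit_stripD[OF ray_in_slit_strip[OF assms(2,3)]]
  have w: "continuous_on {a..} w" and l: "continuous_on {a..} l"
    unfolding w_def l_def using D by (intro continuous_intros continuous_on_Complex_line; simp; fail)+
  have int: "set_integrable lborel {a..} (\<lambda>t. norm (w t) * exp (R * norm (l t)))" if R: "R \<ge> 0" for R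
  proof -
    obtain C where C: "C \<ge> 0" "\<And>x. Re x \<ge> a \<Longrightarrow> \<bar>Im x\<bar> \<le> pi \<Longrightarrow>
        exp (R * norm (Ln (- x))) / norm (exp x - 1) \<le> C * exp (- (1/2) * Re x)"
      using exp_Ln_over_exp_minus_1_decay[OF assms(1) R] by metis
    show ?thesis
    proof (rule set_integrable_Ici_dominated)
      show "continuous_on {a..} (\<lambda>t. norm (w t) * exp (R * norm (l t)))"
        by (intro continuous_intros w l)
      show "set_integrable lborel {a..} (\<lambda>t. (C / a) * exp (- (1/2) * t))"
        by (rule set_integrable_mult_right, rule set_integrable_exp_decay) simp
      fix t assume t: "a \<le> t"
      have "a \<le> norm (Complex t y)" using t complex_Re_le_cmod[of "Complex t y"] by simp
      then have N: "0 < norm (Complex t y)" "a \<le> norm (Complex t y)" using assms(1) by linarith+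
      have "norm (w t) * exp (R * norm (l t)) =
          (exp (R * norm (Ln (- Complex t y))) / norm (exp (Complex t y) - 1)) / norm (Complex t y)"
        unfolding w_def l_def norm_mult norm_divide norm_minus_cancel norm_one by simp
      also have "\<dots> \<le> (exp (R * norm (Ln (- Complex t y))) / norm (exp (Complex t y) - 1)) / a"
        using N assms(1) by (intro divide_left_mono mult_pos_pos) auto
      also have "\<dots> \<le> C * exp (- (1/2) * Re (Complex t y)) / a"
        using t assms by (intro divide_right_mono C) auto
      finally show "norm (norm (w t) * exp (R * norm (l t))) \<le> (C / a) * exp (- (1/2) * t)"
        by simp
    qed
  qed
  have eq: "bose_integrand s (Complex t y) = w t * exp (s * l t)" for s t
    using D(2) by (simp add: bose_integrand_eq_exp w_def l_def)
  show "set_integrable lborel {a..} (\<lambda>t. bose_integrand s (Complex t y))"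
    and "(\<lambda>s. LINT t:{a..}|lborel. bose_integrand s (Complex t y)) holomorphic_on UNIV"
    unfolding eq by (rule entire_set_integral_exp[OF _ w l int]; simp)+
qed

lemma entire_bose_arc:
  assumes "0 < h" "h < r" "r < pi"
  shows "(\<lambda>s. contour_integral (hankel_arc r h) (bose_integrand s)) holomorphic_on UNIV"
proof -
  define \<alpha> where "\<alpha> = arcsin (h / r)"
  define w where "w = (\<lambda>t. 1 / (- (of_real r * cis t) * (exp (of_real r * cis t) - 1)) * r * \<i> * cis t)"
  define l where "l = (\<lambda>t. Ln (- (of_real r * cis t)))"
  have \<alpha>: "\<alpha> < 2 * pi - \<alpha>" "\<alpha> > 0"
    using arc_angle_bounds[OF assms(1,2)] by (auto simp: \<alpha>_def)
  have D: "of_real r * cis t \<in> slit_strip" if "t \<in> {\<alpha>..2 * pi - \<alpha>}" for t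
    using that \<alpha> assms by (intro arc_in_slit_strip) auto
  have w: "continuous_on {\<alpha>..2 * pi - \<alpha>} w" and l: "continuous_on {\<alpha>..2 * pi - \<alpha>} l"
    unfolding w_def l_def using slit_stripD[OF D] assms
    by (auto intro!: continuous_intros simp del: mult_minus_left mult_minus_right)
  have int: "set_integrable lborel {\<alpha>..2 * pi - \<alpha>} (\<lambda>t. norm (w t) * exp (R * norm (l t)))" for R
    by (intro borel_integrable_atLeastAtMost' continuous_intros w l)
  have "contour_integral (hankel_arc r h) (bose_integrand s) =
      (LINT t:{\<alpha>..2 * pi - \<alpha>}|lborel. w t * exp (s * l t))" for s
  proof -
    have "contour_integral (hankel_arc r h) (bose_integrand s) =
        integral {\<alpha>..2 * pi - \<alpha>} (\<lambda>t. bose_integrand s (0 + r * cis t) * r * \<i> * cis t)"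
      unfolding hankel_arc_def \<alpha>_def[symmetric] by (rule contour_integral_part_circlepath_eq[OF \<alpha>(1)])
    also have "\<dots> = integral {\<alpha>..2 * pi - \<alpha>} (\<lambda>t. w t * exp (s * l t))"
      by (rule Henstock_Kurzweil_Integration.integral_cong)
         (use slit_stripD(2)[OF D] in \<open>simp add: bose_integrand_eq_exp w_def l_def\<close>)
    also have "\<dots> = (LINT t:{\<alpha>..2 * pi - \<alpha>}|lborel. w t * exp (s * l t))"
      by (rule set_borel_integral_eq_integral(2)[symmetric], rule entire_set_integral_exp[OF _ w l int]) simp
    finally show ?thesis .
  qed
  then show ?thesis using entire_set_integral_exp(2)[OF _ w l int] by simp
qed

lemma hankel_start_pos: "0 < h \<Longrightarrow> h < r \<Longrightarrow> 0 < sqrt (r\<^sup>2 - h\<^sup>2)"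
  by (simp add: power_strict_mono)

lemma hankel_integrable_bose:
  assumes "0 < h" "h < r" "r < pi"
  shows "hankel_integrable r h (bose_integrand s)"
proof -
  have "continuous_on (path_image (hankel_arc r h)) (bose_integrand s)"
    using holomorphic_bose_integrand path_image_hankel_arc(1)[OF assms]
    by (meson continuous_on_subset holomorphic_on_imp_continuous_on)
  then have "bose_integrand s contour_integrable_on hankel_arc r h"
    unfolding hankel_arc_def by (rule contour_integrable_continuous_part_circlepath)
  then show ?thesis
    using assms hankel_start_pos by (auto simp: hankel_integrable_def intro!: bose_integrand_ray)
qed

lemma entire_hankel_bose:
  assumes "0 < h" "h < r" "r < pi"
  shows "(\<lambda>s. hankel_integral r h (bose_integrand s)) holomorphic_on UNIV"
  unfolding hankel_integral_def using assms hankel_start_pos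
  by (intro holomorphic_intros entire_bose_arc bose_integrand_ray) auto

text \<open>The fundamental theorem of calculus on a horizontal ray.\<close>

lemma ray_primitive_tendsto:
  assumes A: "\<And>t. t \<ge> a \<Longrightarrow> (A has_field_derivative f (Complex t y)) (at (Complex t y))"
    and f: "continuous_on {a..} (\<lambda>t. f (Complex t y))"
    and int: "set_integrable lborel {a..} (\<lambda>t. f (Complex t y))"
  shows "((\<lambda>T. A (Complex T y)) \<longlongrightarrow> A (Complex a y) + (LINT t:{a..}|lborel. f (Complex t y))) at_top"
proof -
  have FTC: "(LINT t:{a..T}|lborel. f (Complex t y)) = A (Complex T y) - A (Complex a y)" if "T \<ge> a" for T
    unfolding set_lebesgue_integral_def
  proof (rule integral_FTC_atLeastAtMost[OF that])
    fix t assume "a \<le> t"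
    have "((\<lambda>t. Complex t y) has_vector_derivative 1) (at t)"
      unfolding Complex_eq has_vector_derivative_def
      by (auto intro!: derivative_eq_intros simp: scaleR_conv_of_real)
    from field_vector_diff_chain_at[OF this A[OF \<open>a \<le> t\<close>]]
    show "((\<lambda>t. A (Complex t y)) has_vector_derivative f (Complex t y)) (at t within {a..T})"
      by (auto simp: o_def intro: has_vector_derivative_at_within)
  next
    show "continuous_on {a..T} (\<lambda>t. f (Complex t y))"
      by (rule continuous_on_subset[OF f]) auto
  qed
  have "((\<lambda>T. A (Complex a y) + (LINT t:{a..T}|lborel. f (Complex t y))) \<longlongrightarrow>
      A (Complex a y) + (LINT t:{a..}|lborel. f (Complex t y))) at_top"
    by (intro tendsto_intros tendsto_set_lebesgue_integral_at_top int) auto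
  moreover have "eventually (\<lambda>T. A (Complex a y) + (LINT t:{a..T}|lborel. f (Complex t y)) = A (Complex T y)) at_top"
    using eventually_ge_at_top[of a] by eventually_elim (simp add: FTC)
  ultimately show ?thesis by (rule Lim_transform_eventually)
qed

text \<open>With a primitive \<open>A\<close> the three pieces of the contour telescope. The formula shows that the
  integral does not depend on \<open>r\<close>, and reduces every later deformation of the contour to a statement
  about boundary values of \<open>A\<close>.\<close>

lemma hankel_integral_primitive:
  assumes hr: "0 < h" "h < r" "r < pi"
    and A: "\<And>x. x \<in> slit_strip \<Longrightarrow> (A has_field_derivative f x) (at x)"
    and f: "continuous_on slit_strip f" and int: "hankel_integrable r h f"
  shows "((\<lambda>t. A (Complex t (- h)) - A (Complex t h)) \<longlongrightarrow> hankel_integral r h f) at_top"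
proof -
  define a where "a = sqrt (r\<^sup>2 - h\<^sup>2)"
  have ray: "((\<lambda>T. A (Complex T y)) \<longlongrightarrow> A (Complex a y) + (LINT t:{a..}|lborel. f (Complex t y))) at_top"
    if y: "y \<noteq> 0" "\<bar>y\<bar> < pi" and i: "set_integrable lborel {a..} (\<lambda>t. f (Complex t y))" for y
    using ray_in_slit_strip[OF y]
    by (intro ray_primitive_tendsto A i continuous_on_compose2[OF f continuous_on_Complex_line]) auto
  have arc: "contour_integral (hankel_arc r h) f = A (Complex a (- h)) - A (Complex a h)"
  proof -
    have "(f has_contour_integral (A (pathfinish (hankel_arc r h)) - A (pathstart (hankel_arc r h)))) (hankel_arc r h)"
      by (rule contour_integral_primitive[where S = slit_strip])
         (use A path_image_hankel_arc(1)[OF hr] in \<open>auto simp: hankel_arc_def intro: has_field_derivative_at_within\<close>)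
    then show ?thesis
      using hankel_arc_ends[OF hr(1,2)] by (simp add: contour_integral_unique a_def)
  qed
  have "((\<lambda>t. A (Complex t (- h)) - A (Complex t h)) \<longlongrightarrow>
     (A (Complex a (- h)) + (LINT t:{a..}|lborel. f (Complex t (- h)))) -
     (A (Complex a h) + (LINT t:{a..}|lborel. f (Complex t h)))) at_top"
    using int hr by (intro tendsto_diff ray) (auto simp: hankel_integrable_def a_def)
  then show ?thesis
    by (simp add: hankel_integral_def arc algebra_simps flip: a_def)
qed

section \<open>Integration by parts\<close>

lemma norm_powr_complex_le: "norm ((z::complex) powr w) \<le> norm z powr Re w * exp (pi * \<bar>Im w\<bar>)"
proof (cases "z = 0")
  case False
  have "\<bar>Im (Ln z)\<bar> \<le> pi" using mpi_less_Im_Ln[OF False] Im_Ln_le_pi[OF False] by auto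
  then have "\<bar>Im w\<bar> * \<bar>Im (Ln z)\<bar> \<le> \<bar>Im w\<bar> * pi" by (intro mult_left_mono) auto
  then have "- (Im w * Im (Ln z)) \<le> pi * \<bar>Im w\<bar>"
    using abs_ge_minus_self[of "Im w * Im (Ln z)"] by (simp add: abs_mult mult.commute)
  then show ?thesis using False by (simp add: powr_def flip: exp_add)
qed simp

lemma powr_add_of_nat: "(z::complex) \<noteq> 0 \<Longrightarrow> z powr (w + of_nat n) = z powr w * z ^ n"
  by (simp add: powr_add powr_nat')

lemma bounded_if_tendsto_at_top:
  fixes f :: "real \<Rightarrow> complex"
  assumes f: "continuous_on {a..} f" and lim: "(f \<longlongrightarrow> L) at_top"
  obtains C where "\<And>t. t \<ge> a \<Longrightarrow> norm (f t) \<le> C"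
proof -
  have "eventually (\<lambda>t. norm (f t) < norm L + 1) at_top"
    using tendsto_norm[OF lim] by (rule order_tendstoD) simp
  then obtain T where T: "\<And>t. t \<ge> T \<Longrightarrow> norm (f t) < norm L + 1"
    by (auto simp: eventually_at_top_linorder)
  have "compact (f ` {a..T})"
    by (intro compact_continuous_image continuous_on_subset[OF f]) auto
  then obtain B where B: "\<And>t. t \<in> {a..T} \<Longrightarrow> norm (f t) \<le> B"
    by (metis bounded_iff compact_imp_bounded imageI)
  show ?thesis
  proof (rule that[of "max B (norm L + 1)"])
    fix t assume "t \<ge> a"
    then show "norm (f t) \<le> max B (norm L + 1)"
      using B[of t] T[of t] by (cases "t \<le> T") auto
  qed
qed

context
  fixes d :: nat and F :: "complex \<Rightarrow> complex"
  assumes F0: "F 0 = 0"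
    and F: "\<And>x. x \<in> strip \<Longrightarrow> (F has_field_derivative x ^ d / fact (Suc d) * bernoulli_gen x) (at x)"
begin

text \<open>The derivative of \<open>F\<close> is \<open>x ^ (d + 1) / (fact (d + 1) * (e\<^sup>x - 1))\<close>, which is integrable along the
  ray.\<close>

lemma primitive_tendsto_on_ray:
  assumes y: "\<bar>y\<bar> < pi"
  obtains L where "((\<lambda>t. F (Complex t y)) \<longlongrightarrow> L) at_top"
proof -
  define f where "f = (\<lambda>x. x ^ d / fact (Suc d) * bernoulli_gen x)"
  have st: "Complex t y \<in> strip" for t using y by simp
  have f: "continuous_on {1..} (\<lambda>t. f (Complex t y))"
  proof (rule continuous_on_compose2[OF _ continuous_on_Complex_line])
    show "continuous_on strip f"
      unfolding f_def using holomorphic_on_imp_continuous_on[OF holomorphic_bernoulli_gen]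
      by (intro continuous_intros) (auto simp del: fact_Suc)
  qed (use st in auto)
  obtain C where C: "C \<ge> 0" "\<And>x. Re x \<ge> 1 \<Longrightarrow> \<bar>Im x\<bar> \<le> pi \<Longrightarrow>
        exp (real (Suc d) * norm (Ln x)) / norm (exp x - 1) \<le> C * exp (- (1/2) * Re x)"
    using exp_Ln_over_exp_minus_1_decay[of 1 "real (Suc d)"] by (metis of_nat_0_le_iff zero_less_one)
  have "set_integrable lborel {1..} (\<lambda>t. f (Complex t y))"
  proof (rule set_integrable_Ici_dominated[OF f])
    show "set_integrable lborel {1..} (\<lambda>t. C * exp (- (1/2) * t))"
      by (rule set_integrable_mult_right, rule set_integrable_exp_decay) simp
    fix t :: real assume t: "1 \<le> t"
    define x where "x = Complex t y"
    have x: "x \<noteq> 0" "Re x \<ge> 1" "\<bar>Im x\<bar> \<le> pi" using t y by (auto simp: x_def complex_eq_iff)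
    have "f x = x ^ Suc d / fact (Suc d) / (exp x - 1)"
      using x by (simp add: f_def bernoulli_gen_def mult_ac)
    also have "norm \<dots> = norm (x ^ Suc d) / fact (Suc d) / norm (exp x - 1)"
      by (simp only: norm_divide norm_fact)
    also have "\<dots> \<le> norm (x ^ Suc d) / 1 / norm (exp x - 1)"
      by (intro divide_right_mono divide_left_mono fact_ge_1) auto
    also have "norm (x ^ Suc d) = norm (exp (of_nat (Suc d) * Ln x))"
      using x(1) by (simp only: exp_of_nat_mult exp_Ln not_False_eq_True)
    also have "\<dots> \<le> exp (norm (of_nat (Suc d) * Ln x))" by (rule norm_exp)
    also have "norm (of_nat (Suc d) * Ln x) = real (Suc d) * norm (Ln x)"
      by (simp only: norm_mult norm_of_nat)
    finally have "norm (f x) \<le> exp (real (Suc d) * norm (Ln x)) / norm (exp x - 1)"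
      by (simp add: divide_right_mono)
    also have "\<dots> \<le> C * exp (- (1/2) * t)" using C(2)[OF x(2,3)] by (simp add: x_def)
    finally show "norm (f (Complex t y)) \<le> C * exp (- (1/2) * t)" by (simp add: x_def)
  qed
  then have "((\<lambda>t. F (Complex t y)) \<longlongrightarrow> F (Complex 1 y) + (LINT t:{1..}|lborel. f (Complex t y))) at_top"
    using F st by (intro ray_primitive_tendsto f) (auto simp: f_def)
  then show ?thesis by (rule that)
qed

lemma continuous_on_primitive: "continuous_on A (\<lambda>t. F (Complex t y))" if "\<bar>y\<bar> < pi"
proof (rule continuous_on_compose2[OF _ continuous_on_Complex_line])
  show "continuous_on strip F" using F by (intro continuous_at_imp_continuous_on) (auto intro: DERIV_isCont)
qed (use that in auto)

lemma zeta_integrand_eq: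
  assumes x: "x \<in> slit_strip"
  shows "zeta_integrand (d + 2) s x = (- 1) ^ (d + 3) * F x * (- x) powr (s - of_nat (d + 3))"
proof -
  have "mpl (2 # replicate (d + 2 - 2) 1) (1 - exp (- x)) = F x"
    using mpl_2_ones_eq_primitive[OF F0 F slit_stripD(1)[OF x]] by simp
  moreover have "(- x) powr s = (- x) powr (s - of_nat (d + 3)) * (- x) ^ (d + 3)"
    using powr_add_of_nat[of "- x" "s - of_nat (d + 3)" "d + 3"] slit_stripD(2)[OF x] by simp
  moreover have "(- x) ^ (d + 3) = (- 1) ^ (d + 3) * x ^ (d + 2) * x"
    by (subst power_minus) (simp add: eval_nat_numeral)
  ultimately show ?thesis using slit_stripD(2)[OF x] by (simp add: zeta_integrand_def)
qed

text \<open>Integration by parts: \<open>F\<close> is differentiated and \<open>(- x) powr (s - m - 1)\<close> is integrated, where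
  \<open>m = d + 2\<close>. In the product of \<open>(- x) powr (s - m)\<close> with the derivative of \<open>F\<close> the factor
  \<open>x ^ (m - 1)\<close> cancels, and a multiple of the classical integrand remains.\<close>

lemma zeta_integrand_primitive:
  assumes x: "x \<in> slit_strip" and s: "s \<noteq> of_nat (d + 2)"
  shows "((\<lambda>x. (- 1) ^ (d + 2) / (s - of_nat (d + 2)) * (F x * (- x) powr (s - of_nat (d + 2))))
     has_field_derivative
       (zeta_integrand (d + 2) s x - bose_integrand s x / ((s - of_nat (d + 2)) * fact (Suc d)))) (at x)"
proof -
  note D = slit_stripD[OF x]
  define P where "P = (- x) powr (s - of_nat (d + 3))"
  define \<sigma> :: complex where "\<sigma> = (- 1) ^ (d + 2)"
  define k where "k = s - of_nat (d + 2)"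
  have k: "k \<noteq> 0" using s by (simp add: k_def)
  have "k - 1 = s - of_nat (d + 3)" by (simp add: k_def)
  then have k1: "(- x) powr (k - 1) = P" by (simp only: P_def)
  then have k0: "(- x) powr k = P * (- x)"
    using powr_add_of_nat[of "- x" "k - 1" 1] D by simp
  have s1: "(s - of_nat (d + 3)) + of_nat (d + 2) = s - 1" by simp
  have "(- x) powr (s - 1) = P * (- x) ^ (d + 2)"
    using powr_add_of_nat[of "- x" "s - of_nat (d + 3)" "d + 2", unfolded s1] D(2) by (simp only: P_def) simp
  also have "(- x) ^ (d + 2) = \<sigma> * x ^ (d + 2)" by (subst power_minus) (simp add: \<sigma>_def)
  finally have bose: "bose_integrand s x = P * \<sigma> * x ^ (d + 2) / (exp x - 1)"
    by (simp add: bose_integrand_def)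
  have zi: "zeta_integrand (d + 2) s x = - \<sigma> * F x * P"
    unfolding zeta_integrand_eq[OF x] P_def[symmetric] \<sigma>_def by (simp add: eval_nat_numeral)
  have "((\<lambda>x. (- x) powr k) has_field_derivative (k * (- x) powr (k - 1)) * (- 1)) (at x)"
    by (rule DERIV_chain2[of "\<lambda>z. z powr k" "k * (- x) powr (k - 1)" uminus,
          OF has_field_derivative_powr[OF D(3)]]) (auto intro!: derivative_eq_intros)
  from DERIV_cmult[OF DERIV_mult[OF F[OF D(1)] this], of "\<sigma> / k"]
  have "((\<lambda>x. \<sigma> / k * (F x * (- x) powr k)) has_field_derivative
      \<sigma> / k * (x ^ d / fact (Suc d) * bernoulli_gen x * (P * (- x)) + (k * P * (- 1)) * F x)) (at x)"
    by (simp only: k1 k0)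
  also have "\<sigma> / k * (x ^ d / fact (Suc d) * bernoulli_gen x * (P * (- x)) + (k * P * (- 1)) * F x)
      = zeta_integrand (d + 2) s x - bose_integrand s x / (k * fact (Suc d))"
  proof -
    have "\<sigma> / k * (x ^ d / f * (x / E) * (P * (- x)) + (k * P * (- 1)) * F x) =
        - \<sigma> * F x * P - P * \<sigma> * x ^ (d + 2) / E / (k * f)" if "E \<noteq> 0" "f \<noteq> 0" for E f :: complex
      using that k
      by (simp add: distrib_left right_diff_distrib diff_divide_distrib power_add power2_eq_square mult_ac)
    from this[of "exp x - 1" "fact (Suc d)"] show ?thesis
      unfolding zi bose using D(2,4) by (simp add: bernoulli_gen_def del: fact_Suc)
  qed
  finally show ?thesis by (simp only: \<sigma>_def k_def)
qed

lemma continuous_on_zeta_integrand: "continuous_on slit_strip (zeta_integrand (d + 2) s)"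
proof -
  have "continuous_on slit_strip (\<lambda>x. (- 1) ^ (d + 3) * F x * (- x) powr (s - of_nat (d + 3)))"
  proof (rule holomorphic_on_imp_continuous_on)
    have "F holomorphic_on slit_strip"
      using F slit_stripD(1) by (meson field_differentiable_at_within field_differentiable_def holomorphic_on_def)
    then show "(\<lambda>x. (- 1) ^ (d + 3) * F x * (- x) powr (s - of_nat (d + 3))) holomorphic_on slit_strip"
      by (intro holomorphic_intros slit_stripD(3))
  qed
  then show ?thesis by (rule continuous_on_eq) (simp only: zeta_integrand_eq)
qed

text \<open>Along the rays \<open>F\<close> is bounded, so the integrand is of the order of \<open>t powr (Re s - m - 1)\<close>; this
  is where \<open>Re s < m\<close> is needed.\<close>

lemma hankel_integrable_zeta_integrand_aux:
  assumes hr: "0 < h" "h < r" "r < pi" and s: "Re s < real (d + 2)"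
  shows "hankel_integrable r h (zeta_integrand (d + 2) s)"
proof -
  define a where "a = sqrt (r\<^sup>2 - h\<^sup>2)"
  have a: "a > 0" using hankel_start_pos[OF hr(1,2)] by (simp add: a_def)
  have ray: "set_integrable lborel {a..} (\<lambda>t. zeta_integrand (d + 2) s (Complex t y))"
    if y: "y \<noteq> 0" "\<bar>y\<bar> < pi" for y
  proof -
    obtain L where "((\<lambda>t. F (Complex t y)) \<longlongrightarrow> L) at_top"
      using primitive_tendsto_on_ray[OF y(2)] .
    then obtain C where C: "\<And>t. t \<ge> a \<Longrightarrow> norm (F (Complex t y)) \<le> C"
      using bounded_if_tendsto_at_top[OF continuous_on_primitive[OF y(2)]] by metis
    have "C \<ge> 0" using C[of a] norm_ge_zero order_trans by blast
    define w where "w = s - of_nat (d + 3)"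
    have w: "Re w < - 1" using s by (simp add: w_def)
    show ?thesis
    proof (rule set_integrable_Ici_dominated)
      show "continuous_on {a..} (\<lambda>t. zeta_integrand (d + 2) s (Complex t y))"
        by (rule continuous_on_compose2[OF continuous_on_zeta_integrand continuous_on_Complex_line])
           (use ray_in_slit_strip[OF y] in auto)
      show "set_integrable lborel {a..} (\<lambda>t. C * (exp (pi * \<bar>Im w\<bar>) * t powr Re w))"
        by (intro set_integrable_mult_right set_integrable_powr_decay w a)
      fix t assume t: "a \<le> t"
      let ?x = "Complex t y"
      have "norm ((- ?x) powr w) \<le> norm ?x powr Re w * exp (pi * \<bar>Im w\<bar>)"
        using norm_powr_complex_le[of "- ?x" w] by simp
      also have "norm ?x powr Re w \<le> t powr Re w"
        using complex_Re_le_cmod[of ?x] t a w by (intro powr_mono2') auto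
      finally have *: "norm ((- ?x) powr w) \<le> exp (pi * \<bar>Im w\<bar>) * t powr Re w"
        by (simp add: mult_ac)
      have "norm (zeta_integrand (d + 2) s ?x) = norm (F ?x) * norm ((- ?x) powr w)"
        using zeta_integrand_eq[OF ray_in_slit_strip[OF y]] by (simp add: norm_mult norm_power w_def)
      also have "\<dots> \<le> C * (exp (pi * \<bar>Im w\<bar>) * t powr Re w)"
        by (rule mult_mono[OF C[OF t] * \<open>C \<ge> 0\<close>]) auto
      finally show "norm (zeta_integrand (d + 2) s ?x) \<le> C * (exp (pi * \<bar>Im w\<bar>) * t powr Re w)" .
    qed
  qed
  have "zeta_integrand (d + 2) s contour_integrable_on hankel_arc r h"
    using continuous_on_subset[OF continuous_on_zeta_integrand path_image_hankel_arc(1)[OF hr]]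
    unfolding hankel_arc_def by (rule contour_integrable_continuous_part_circlepath)
  then show ?thesis
    unfolding hankel_integrable_def a_def[symmetric] using hr by (intro conjI ray) auto
qed

text \<open>The boundary term of the integration by parts tends to \<open>0\<close> along both rays, because \<open>F\<close> has
  limits there and \<open>(- x) powr (s - m)\<close> tends to \<open>0\<close> for \<open>Re s < m\<close>.\<close>

lemma hankel_integral_zeta_integrand_aux:
  assumes hr: "0 < h" "h < r" "r < pi" and s: "Re s < real (d + 2)"
  shows "hankel_integral r h (zeta_integrand (d + 2) s) =
           hankel_integral r h (bose_integrand s) / ((s - of_nat (d + 2)) * fact (Suc d))"
proof -
  define k where "k = s - of_nat (d + 2)"
  have sk: "s \<noteq> of_nat (d + 2)"
  proof
    assume "s = of_nat (d + 2)"
    then have "Re s = real (d + 2)" by (simp only: complex_Re_of_nat)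
    with s show False by simp
  qed
  define c where "c = k * fact (Suc d)"
  define G where "G = (\<lambda>x. (- 1) ^ (d + 2) / k * (F x * (- x) powr k))"
  obtain A where A: "\<And>x. x \<in> slit_strip \<Longrightarrow> (A has_field_derivative bose_integrand s x) (at x)"
    using bose_integrand_primitive[of s] by blast
  have cont: "continuous_on slit_strip (bose_integrand s)"
    by (rule holomorphic_on_imp_continuous_on[OF holomorphic_bose_integrand])
  have limA: "((\<lambda>t. A (Complex t (- h)) - A (Complex t h)) \<longlongrightarrow> hankel_integral r h (bose_integrand s)) at_top"
    by (rule hankel_integral_primitive[OF hr A cont hankel_integrable_bose[OF hr]])
  have "((\<lambda>x. G x + A x / c) has_field_derivative zeta_integrand (d + 2) s x) (at x)"
    if "x \<in> slit_strip" for x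
    using DERIV_add[OF zeta_integrand_primitive[OF that sk] DERIV_cdivide[OF A[OF that], of c]]
    by (simp only: G_def k_def c_def diff_add_cancel)
  then have lim: "((\<lambda>t. (G (Complex t (- h)) + A (Complex t (- h)) / c) - (G (Complex t h) + A (Complex t h) / c))
      \<longlongrightarrow> hankel_integral r h (zeta_integrand (d + 2) s)) at_top"
    by (rule hankel_integral_primitive[OF hr _ continuous_on_zeta_integrand
          hankel_integrable_zeta_integrand_aux[OF hr s]])
  have G0: "((\<lambda>t. G (Complex t y)) \<longlongrightarrow> 0) at_top" if y: "\<bar>y\<bar> < pi" for y
  proof -
    obtain L where L: "((\<lambda>t. F (Complex t y)) \<longlongrightarrow> L) at_top"
      using primitive_tendsto_on_ray[OF y] .
    have Rek: "Re k < 0" using s by (simp add: k_def)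
    have "((\<lambda>t. (- Complex t y) powr k) \<longlongrightarrow> 0) at_top"
    proof (rule Lim_null_comparison)
      show "eventually (\<lambda>t. norm ((- Complex t y) powr k) \<le> t powr Re k * exp (pi * \<bar>Im k\<bar>)) at_top"
        using eventually_gt_at_top[of 0]
      proof eventually_elim
        case (elim t)
        have "norm ((- Complex t y) powr k) \<le> norm (Complex t y) powr Re k * exp (pi * \<bar>Im k\<bar>)"
          using norm_powr_complex_le[of "- Complex t y" k] by simp
        also have "norm (Complex t y) powr Re k \<le> t powr Re k"
          using complex_Re_le_cmod[of "Complex t y"] elim Rek by (intro powr_mono2') auto
        finally show ?case by simp
      qed
      show "((\<lambda>t. t powr Re k * exp (pi * \<bar>Im k\<bar>)) \<longlongrightarrow> 0) at_top"
        using tendsto_mult_left_zero[OF tendsto_neg_powr[OF Rek filterlim_ident]] by simp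
    qed
    then have "((\<lambda>t. G (Complex t y)) \<longlongrightarrow> (- 1) ^ (d + 2) / k * (L * 0)) at_top"
      unfolding G_def by (intro tendsto_mult tendsto_const L)
    then show ?thesis by (simp only: mult_zero_right)
  qed
  have "((\<lambda>t. (A (Complex t (- h)) - A (Complex t h)) / c + (G (Complex t (- h)) - G (Complex t h)))
      \<longlongrightarrow> hankel_integral r h (bose_integrand s) / c + (0 - 0)) at_top"
    using hr by (intro tendsto_add tendsto_diff[OF G0 G0] tendsto_divide limA tendsto_const)
                (use sk in \<open>auto simp: c_def k_def simp del: fact_Suc of_nat_add\<close>)
  then have "((\<lambda>t. (G (Complex t (- h)) + A (Complex t (- h)) / c) - (G (Complex t h) + A (Complex t h) / c))
      \<longlongrightarrow> hankel_integral r h (bose_integrand s) / c) at_top"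
    by (simp add: diff_divide_distrib algebra_simps)
  from tendsto_unique[OF _ lim this] show ?thesis by (simp add: c_def k_def)
qed

end

lemma hankel_integrable_zeta_integrand:
  assumes "0 < h" "h < r" "r < pi" "m \<ge> 2" "Re s < real m"
  shows "hankel_integrable r h (zeta_integrand m s)"
proof -
  obtain d where m: "m = d + 2" using assms by (metis add.commute le_Suc_ex)
  obtain F where "F 0 = 0"
    "\<And>x. x \<in> strip \<Longrightarrow> (F has_field_derivative x ^ d / fact (Suc d) * bernoulli_gen x) (at x)"
    using strip_primitive_exists by metis
  from hankel_integrable_zeta_integrand_aux[OF this assms(1-3)] assms(5) show ?thesis by (simp add: m)
qed

lemma hankel_integral_zeta_integrand:
  assumes "0 < h" "h < r" "r < pi" "m \<ge> 2" "Re s < real m"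
  shows "hankel_integral r h (zeta_integrand m s) =
           hankel_integral r h (bose_integrand s) / ((s - of_nat m) * Gamma (of_nat m))"
proof -
  obtain d where m: "m = d + 2" using assms by (metis add.commute le_Suc_ex)
  obtain F where "F 0 = 0"
    "\<And>x. x \<in> strip \<Longrightarrow> (F has_field_derivative x ^ d / fact (Suc d) * bernoulli_gen x) (at x)"
    using strip_primitive_exists by metis
  from hankel_integral_zeta_integrand_aux[OF this assms(1-3)] assms(5)
  show ?thesis using Gamma_fact[of "Suc d", where 'a = complex] by (simp add: m add_ac)
qed

section \<open>The Mellin transform of the Bose kernel\<close>

lemma summable_zeta_real:
  assumes "(\<sigma>::real) > 1" shows "summable (\<lambda>n. 1 / real (Suc n) powr \<sigma>)"
proof -
  have "summable (\<lambda>n. real n powr (- \<sigma>))" using assms by (simp add: summable_real_powr_iff)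
  then have "summable (\<lambda>n. real (Suc n) powr (- \<sigma>))" by (subst summable_Suc_iff)
  then show ?thesis by (simp add: powr_minus_divide)
qed

lemma scaled_Gamma_integral:
  fixes s :: complex
  assumes s: "Re s > 0" and c: "c > 0"
  shows "set_integrable lborel {0<..} (\<lambda>t. of_real t powr (s - 1) / of_real (exp (c * t)))"
    and "(LINT t:{0<..}|lborel. of_real t powr (s - 1) / of_real (exp (c * t))) =
           Gamma s / of_real c powr s"
proof -
  have int: "set_integrable lborel {0<..} (\<lambda>t. of_real t powr (s - 1) / of_real (exp (c * t)))" if "c > 0" for c
  proof -
    have "continuous_on {0<..} (\<lambda>t. complex_of_real t powr (s - 1) / of_real (exp (c * t)))"
      by (intro continuous_intros) (auto simp: complex_nonpos_Reals_iff)
    from borel_measurable_continuous_on_indicator[OF _ this]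
         absolutely_integrable_Gamma_integral[OF s that]
    show ?thesis by (simp add: set_integrable_def integrable_completion)
  qed
  show "set_integrable lborel {0<..} (\<lambda>t. of_real t powr (s - 1) / of_real (exp (c * t)))"
    by (rule int[OF c])
  define f where "f = (\<lambda>t. indicator {0<..} t *\<^sub>R (complex_of_real t powr (s - 1) / of_real (exp t)))"
  have "(LINT t:{0<..}|lborel. of_real t powr (s - 1) / of_real (exp t)) = Gamma s"
    using set_borel_integral_eq_integral(2)[OF int[of 1]] Gamma_integral_complex'[OF s]
    by (simp add: integral_unique)
  then have "Gamma s = (\<integral>t. f t \<partial>lborel)" by (simp add: set_lebesgue_integral_def f_def)
  also have "\<dots> = \<bar>c\<bar> *\<^sub>R (\<integral>t. f (0 + c * t) \<partial>lborel)"
    using c by (intro lborel_integral_real_affine) simp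
  also have "(\<lambda>t. f (0 + c * t)) = (\<lambda>t. of_real c powr (s - 1) *
      (indicator {0<..} t *\<^sub>R (complex_of_real t powr (s - 1) / of_real (exp (c * t)))))"
    using c by (auto simp: f_def indicator_def powr_times_real zero_less_mult_iff fun_eq_iff)
  also have "\<bar>c\<bar> *\<^sub>R (\<integral>t. of_real c powr (s - 1) *
      (indicator {0<..} t *\<^sub>R (complex_of_real t powr (s - 1) / of_real (exp (c * t)))) \<partial>lborel)
      = of_real c * of_real c powr (s - 1) *
         (LINT t:{0<..}|lborel. of_real t powr (s - 1) / of_real (exp (c * t)))"
    unfolding set_lebesgue_integral_def integral_mult_right_zero
    using c by (simp only: scaleR_conv_of_real abs_of_pos mult.assoc)
  also have "of_real c * of_real c powr (s - 1) = of_real c powr s"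
    using c by (simp add: powr_diff)
  finally show "(LINT t:{0<..}|lborel. of_real t powr (s - 1) / of_real (exp (c * t))) =
      Gamma s / of_real c powr s"
    using c by simp
qed

text \<open>For \<open>t > 0\<close> the kernel \<open>1 / (e\<^sup>t - 1)\<close> is the sum of \<open>e\<^sup>-\<^sup>n\<^sup>t\<close> over \<open>n \<ge> 1\<close>. Each term contributes a scaled
  Gamma integral, and the interchange is justified by the convergence of the zeta series at \<open>Re s\<close>.\<close>

lemma Mellin_transform_bose:
  fixes s :: complex
  assumes s: "Re s > 1"
  shows "set_integrable lborel {0<..} (\<lambda>t. of_real t powr (s - 1) / (exp (of_real t) - 1))"
    and "(LINT t:{0<..}|lborel. of_real t powr (s - 1) / (exp (of_real t) - 1)) =
           Gamma s * (\<Sum>n. 1 / of_nat (Suc n) powr s)"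
proof -
  define f :: "nat \<Rightarrow> real \<Rightarrow> complex" where
    "f = (\<lambda>n t. indicator {0<..} t *\<^sub>R (of_real t powr (s - 1) / of_real (exp (real (Suc n) * t))))"
  define \<sigma> where "\<sigma> = Re s"
  have f_int: "integrable lborel (f n)" for n
    using scaled_Gamma_integral(1)[of s "real (Suc n)"] s by (simp add: set_integrable_def f_def)
  have I: "(\<integral>t. f n t \<partial>lborel) = Gamma s * (1 / of_nat (Suc n) powr s)" for n
    using scaled_Gamma_integral(2)[of s "real (Suc n)"] s
    by (simp add: set_lebesgue_integral_def f_def del: of_nat_Suc)
  have norm_f: "norm (f n t) =
      indicator {0<..} t *\<^sub>R (t powr (\<sigma> - 1) / exp (real (Suc n) * t))" for n t
    by (auto simp: f_def indicator_def norm_divide norm_powr_real_powr \<sigma>_def simp del: of_nat_Suc)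
  \<comment> \<open>The absolute values are the same integrands at the real point \<open>\<sigma>\<close>, so their integrals are known too.\<close>
  have J: "(\<integral>t. norm (f n t) \<partial>lborel) = norm (Gamma (complex_of_real \<sigma>)) * (1 / real (Suc n) powr \<sigma>)" for n
  proof -
    have "complex_of_real (\<integral>t. norm (f n t) \<partial>lborel) = (\<integral>t. complex_of_real (norm (f n t)) \<partial>lborel)"
      by simp
    also have "\<dots> = (LINT t:{0<..}|lborel. of_real t powr (complex_of_real \<sigma> - 1) / of_real (exp (real (Suc n) * t)))"
      unfolding set_lebesgue_integral_def norm_f
    proof (rule Bochner_Integration.integral_cong[OF refl])
      fix t
      have "complex_of_real t powr (complex_of_real \<sigma> - 1) = complex_of_real (t powr (\<sigma> - 1))" if "t > 0"
        using that powr_of_real[of t "\<sigma> - 1"] by simp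
      then show "complex_of_real (indicator {0<..} t *\<^sub>R (t powr (\<sigma> - 1) / exp (real (Suc n) * t))) =
        indicator {0<..} t *\<^sub>R (of_real t powr (complex_of_real \<sigma> - 1) / of_real (exp (real (Suc n) * t)))"
        by (auto simp: indicator_def simp del: of_nat_Suc)
    qed
    also have "\<dots> = Gamma (complex_of_real \<sigma>) / of_real (real (Suc n)) powr complex_of_real \<sigma>"
      using s by (intro scaled_Gamma_integral) (auto simp: \<sigma>_def)
    finally have "norm (complex_of_real (\<integral>t. norm (f n t) \<partial>lborel)) =
        norm (Gamma (complex_of_real \<sigma>) / of_real (real (Suc n)) powr complex_of_real \<sigma>)"
      by (rule arg_cong)
    moreover have "0 \<le> (\<integral>t. norm (f n t) \<partial>lborel)" by simp
    ultimately show ?thesis by (simp add: norm_divide norm_powr_real_powr del: of_nat_Suc)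
  qed
  have pt: "(\<lambda>n. f n t) sums (indicator {0<..} t *\<^sub>R (of_real t powr (s - 1) / (exp (of_real t) - 1)))"
    and pt_norm: "summable (\<lambda>n. norm (f n t))" for t
  proof -
    define q where "q = exp (- t)"
    have q_power: "q * q ^ n = 1 / exp (real (Suc n) * t)" for n
    proof -
      have "q * q ^ n = exp (real (Suc n) * - t)"
        unfolding q_def exp_of_nat_mult by simp
      then show ?thesis by (simp only: mult_minus_right exp_minus inverse_eq_divide)
    qed
    show "summable (\<lambda>n. norm (f n t))"
    proof (cases "t > 0")
      case True
      then have "summable (\<lambda>n. t powr (\<sigma> - 1) * q * q ^ n)"
        by (intro summable_mult summable_geometric) (simp add: q_def)
      also have "(\<lambda>n. t powr (\<sigma> - 1) * q * q ^ n) = (\<lambda>n. norm (f n t))"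
        using True by (simp add: fun_eq_iff norm_f mult.assoc q_power del: of_nat_Suc)
      finally show ?thesis .
    qed (simp add: f_def)
    show "(\<lambda>n. f n t) sums (indicator {0<..} t *\<^sub>R (of_real t powr (s - 1) / (exp (of_real t) - 1)))"
    proof (cases "t > 0")
      case True
      define Q where "Q = complex_of_real q"
      have "(\<lambda>n. (of_real t powr (s - 1) * Q) * Q ^ n) sums ((of_real t powr (s - 1) * Q) * (1 / (1 - Q)))"
        using True by (intro sums_mult geometric_sums) (simp add: q_def Q_def)
      also have "(\<lambda>n. (of_real t powr (s - 1) * Q) * Q ^ n) = (\<lambda>n. f n t)"
      proof
        fix n
        have "Q * Q ^ n = 1 / of_real (exp (real (Suc n) * t))"
          using arg_cong[OF q_power[of n], of complex_of_real]
          by (simp only: Q_def of_real_mult of_real_power of_real_divide of_real_1)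
        then show "(of_real t powr (s - 1) * Q) * Q ^ n = f n t"
          using True by (simp add: f_def mult.assoc del: of_nat_Suc)
      qed
      also have "(of_real t powr (s - 1) * Q) * (1 / (1 - Q)) = of_real t powr (s - 1) / (exp (of_real t) - 1)"
      proof -
        have "Q = 1 / exp (of_real t)" by (simp add: Q_def q_def exp_minus exp_of_real divide_inverse)
        then have "1 - Q = (exp (of_real t) - 1) / exp (of_real t)"
          by (simp add: diff_divide_distrib)
        with \<open>Q = 1 / exp (of_real t)\<close> show ?thesis by simp
      qed
      finally show ?thesis using True by simp
    qed (simp add: f_def)
  qed
  have sums: "summable (\<lambda>n. \<integral>t. norm (f n t) \<partial>lborel)"
    unfolding J using s by (intro summable_mult summable_zeta_real) (simp add: \<sigma>_def)
  have suminf_f: "(\<lambda>t. \<Sum>n. f n t) =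
      (\<lambda>t. indicator {0<..} t *\<^sub>R (of_real t powr (s - 1) / (exp (of_real t) - 1)))"
    using pt by (simp add: sums_iff)
  have AE: "AE t in lborel. summable (\<lambda>n. norm (f n t))" using pt_norm by simp
  show "set_integrable lborel {0<..} (\<lambda>t. of_real t powr (s - 1) / (exp (of_real t) - 1))"
    using integrable_suminf[OF f_int AE sums] by (simp add: suminf_f set_integrable_def)
  have "(\<lambda>n. 1 / of_nat (Suc n) powr s) sums
      ((LINT t:{0<..}|lborel. of_real t powr (s - 1) / (exp (of_real t) - 1)) / Gamma s)"
  proof -
    have "Gamma s \<noteq> 0" using s by (auto simp: Gamma_eq_zero_iff elim!: nonpos_Ints_cases)
    with sums_divide[OF sums_integral[OF f_int AE sums], of "Gamma s"] show ?thesis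
      by (simp add: I suminf_f set_lebesgue_integral_def del: of_nat_Suc)
  qed
  moreover have "Gamma s \<noteq> 0" using s by (auto simp: Gamma_eq_zero_iff elim!: nonpos_Ints_cases)
  ultimately show "(LINT t:{0<..}|lborel. of_real t powr (s - 1) / (exp (of_real t) - 1)) =
           Gamma s * (\<Sum>n. 1 / of_nat (Suc n) powr s)"
    by (simp add: sums_iff del: of_nat_Suc)
qed

section \<open>Collapsing the contour\<close>

text \<open>The kernel \<open>1 / (e\<^sup>x - 1)\<close> has a simple pole at \<open>0\<close>.\<close>

lemma bose_integrand_near_0:
  obtains K where "K \<ge> 0"
    and "\<And>x. x \<in> slit_strip \<Longrightarrow> norm x \<le> 1 \<Longrightarrow> norm (bose_integrand s x) \<le> K * norm x powr (Re s - 2)"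
proof -
  have cball: "cball 0 1 \<subseteq> strip"
  proof
    fix x :: complex assume "x \<in> cball 0 1"
    then have "\<bar>Im x\<bar> \<le> 1" using abs_Im_le_cmod[of x] by simp
    then show "x \<in> strip" using pi_gt3 by simp
  qed
  have "continuous_on (cball 0 1) bernoulli_gen"
    using holomorphic_bernoulli_gen cball by (meson continuous_on_subset holomorphic_on_imp_continuous_on)
  then have "compact (bernoulli_gen ` cball 0 1)" by (intro compact_continuous_image) auto
  then obtain B where B: "\<And>x. x \<in> cball 0 1 \<Longrightarrow> norm (bernoulli_gen x) \<le> B"
    by (metis bounded_iff compact_imp_bounded imageI)
  have "B \<ge> 0" using order_trans[OF norm_ge_zero B[of 0]] by simp
  show ?thesis
  proof (rule that[of "exp (pi * \<bar>Im s\<bar>) * B"])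
    fix x assume x: "x \<in> slit_strip" "norm x \<le> 1"
    note D = slit_stripD[OF x(1)]
    have "bose_integrand s x = (- x) powr (s - 1) * bernoulli_gen x / x"
      using D(2) by (simp add: bose_integrand_def bernoulli_gen_def)
    then have "norm (bose_integrand s x) = norm ((- x) powr (s - 1)) * norm (bernoulli_gen x) / norm x"
      by (simp add: norm_mult norm_divide)
    also have "\<dots> \<le> (norm (- x) powr Re (s - 1) * exp (pi * \<bar>Im (s - 1)\<bar>)) * B / norm x"
      using x \<open>B \<ge> 0\<close> by (intro divide_right_mono mult_mono norm_powr_complex_le B) auto
    also have "\<dots> = exp (pi * \<bar>Im s\<bar>) * B * (norm x powr (Re s - 1) / norm x)" by simp
    also have "norm x powr (Re s - 1) / norm x = norm x powr (Re s - 2)"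
      using D(2) powr_diff[of "norm x" "Re s - 1" 1] by simp
    finally show "norm (bose_integrand s x) \<le> exp (pi * \<bar>Im s\<bar>) * B * norm x powr (Re s - 2)" .
  qed (use \<open>B \<ge> 0\<close> in simp)
qed

text \<open>Collapsing the contour onto the positive axis. Let \<open>A\<close> be a primitive of the integrand on the slit
  strip and \<open>B\<close> one of \<open>x powr (s - 1) / (e\<^sup>x - 1)\<close> on its right half, where no slit is needed. Above
  and below the axis the two integrands differ by the constant factors \<open>up\<close> and \<open>lo\<close>, so there \<open>A\<close> is
  an affine function of \<open>B\<close>, with additive constants \<open>c_up\<close> and \<open>c_lo\<close>. The jump of \<open>A\<close> at infinity is
  the Hankel integral; its jump \<open>\<Delta> \<epsilon>\<close> across the point \<open>\<epsilon>\<close> of the axis is the integral over a circle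
  of radius \<open>\<epsilon>\<close>, which is \<open>O(\<epsilon> powr (Re s - 1))\<close> and vanishes in the limit. The difference of the two jumps
  is \<open>lo - up\<close> times the integral over \<open>[\<epsilon>, \<infinity>)\<close>.\<close>

lemma hankel_integral_bose_eq_Mellin:
  assumes hr: "0 < h" "h < r" "r < pi" and s: "Re s > 1"
  shows "hankel_integral r h (bose_integrand s) =
     (exp (\<i> * pi * (s - 1)) - exp (- (\<i> * pi * (s - 1)))) *
     (LINT t:{0<..}|lborel. of_real t powr (s - 1) / (exp (of_real t) - 1))"
proof -
  define H where "H = hankel_integral r h (bose_integrand s)"
  define lo where "lo = exp (\<i> * pi * (s - 1))"
  define up where "up = exp (- (\<i> * pi * (s - 1)))"
  define f where "f = (\<lambda>x. x powr (s - 1) / (exp x - 1))"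
  define U where "U = strip \<inter> {x. Re x > 0}"
  have U: "open U" "convex U"
    unfolding U_def by (intro open_Int open_strip open_halfspace_Re_gt convex_Int convex_strip convex_halfspace_Re_gt)+
  have UD: "x \<notin> \<real>\<^sub>\<le>\<^sub>0" "x \<noteq> 0" "exp x - 1 \<noteq> 0" if "x \<in> U" for x
  proof -
    show "x \<notin> \<real>\<^sub>\<le>\<^sub>0" using that by (auto simp: U_def complex_nonpos_Reals_iff)
    show x: "x \<noteq> 0" using that by (auto simp: U_def)
    have "x \<in> strip" using that by (simp add: U_def)
    then show "exp x - 1 \<noteq> 0" using exp_neq_1_on_strip x by simp
  qed
  have f_holo: "f holomorphic_on U"
    unfolding f_def using UD by (intro holomorphic_intros) auto
  obtain B where B: "\<And>x. x \<in> U \<Longrightarrow> (B has_field_derivative f x) (at x)"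
    using holomorphic_convex_primitive'[OF U(2,1) f_holo] at_within_open[OF _ U(1)] by metis
  have bose_cont: "continuous_on slit_strip (bose_integrand s)"
    by (rule holomorphic_on_imp_continuous_on[OF holomorphic_bose_integrand])
  obtain A where A: "\<And>x. x \<in> slit_strip \<Longrightarrow> (A has_field_derivative bose_integrand s x) (at x)"
    using bose_integrand_primitive[of s] by blast
  have lim_H: "((\<lambda>t. A (Complex t (- h)) - A (Complex t h)) \<longlongrightarrow> H) at_top"
    unfolding H_def by (rule hankel_integral_primitive[OF hr A bose_cont hankel_integrable_bose[OF hr]])

  have bose_up: "bose_integrand s x = up * f x" if "Im x > 0" for x
    using minus_powr_upper_lower(1)[OF that, of "s - 1"] that
    by (auto simp: bose_integrand_def f_def up_def powr_def algebra_simps simp flip: exp_add)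
  have bose_lo: "bose_integrand s x = lo * f x" if "Im x < 0" for x
    using minus_powr_upper_lower(2)[OF that, of "s - 1"] that
    by (auto simp: bose_integrand_def f_def lo_def powr_def algebra_simps simp flip: exp_add)
  have const: "\<exists>c. \<forall>x\<in>V. A x - k * B x = c"
    if V: "convex V" "V \<subseteq> U" "V \<subseteq> slit_strip" and eq: "\<And>x. x \<in> V \<Longrightarrow> bose_integrand s x = k * f x" for V k
  proof (rule has_field_derivative_zero_constant[OF V(1)])
    fix x assume x: "x \<in> V"
    have "((\<lambda>x. A x - k * B x) has_field_derivative bose_integrand s x - k * f x) (at x)"
      using x V by (intro DERIV_diff DERIV_cmult A B) auto
    then show "((\<lambda>x. A x - k * B x) has_field_derivative 0) (at x within V)"
      using eq[OF x] by (simp add: has_field_derivative_at_within)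
  qed
  have "\<exists>c. \<forall>x\<in>U \<inter> {x. Im x > 0}. A x - up * B x = c"
    using bose_up by (intro const convex_Int U convex_halfspace_Im_gt)
      (auto simp: U_def slit_strip_def complex_nonneg_Reals_iff)
  then obtain c_up where c_up: "\<And>x. x \<in> U \<Longrightarrow> Im x > 0 \<Longrightarrow> A x = up * B x + c_up"
    by (fastforce simp: algebra_simps)
  have "\<exists>c. \<forall>x\<in>U \<inter> {x. Im x < 0}. A x - lo * B x = c"
    using bose_lo by (intro const convex_Int U convex_halfspace_Im_lt)
      (auto simp: U_def slit_strip_def complex_nonneg_Reals_iff)
  then obtain c_lo where c_lo: "\<And>x. x \<in> U \<Longrightarrow> Im x < 0 \<Longrightarrow> A x = lo * B x + c_lo"
    by (fastforce simp: algebra_simps)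

  \<comment> \<open>The integrand decays uniformly in the strip, so all horizontal lines give the same limit of \<open>B\<close>.\<close>
  have vertical: "((\<lambda>t. B (Complex t y) - B (Complex t 0)) \<longlongrightarrow> 0) at_top" if y: "\<bar>y\<bar> < pi" for y
  proof -
    obtain C where C: "C \<ge> 0" "\<And>x. Re x \<ge> 1 \<Longrightarrow> \<bar>Im x\<bar> \<le> pi \<Longrightarrow>
        exp (norm (s - 1) * norm (Ln x)) / norm (exp x - 1) \<le> C * exp (- (1/2) * Re x)"
      using exp_Ln_over_exp_minus_1_decay[of 1 "norm (s - 1)"] by (metis norm_ge_zero zero_less_one)
    show ?thesis
    proof (rule Lim_null_comparison)
      show "eventually (\<lambda>t. norm (B (Complex t y) - B (Complex t 0)) \<le> C * exp (- (1/2) * t) * norm (Complex t y - Complex t 0)) at_top"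
        using eventually_ge_at_top[of 1]
      proof eventually_elim
        case (elim t)
        have seg: "Re x = t \<and> \<bar>Im x\<bar> < pi" if x: "x \<in> closed_segment (Complex t y) (Complex t 0)" for x
        proof -
          obtain u where u: "0 \<le> u" "u \<le> 1" "x = (1 - u) *\<^sub>R Complex t y + u *\<^sub>R Complex t 0"
            using x by (auto simp: closed_segment_def)
          have "\<bar>(1 - u) * y\<bar> \<le> 1 * \<bar>y\<bar>" unfolding abs_mult using u by (intro mult_right_mono) auto
          moreover have "Re x = t" "Im x = (1 - u) * y" unfolding u(3) by (simp_all add: left_diff_distrib)
          ultimately show ?thesis using y by simp
        qed
        show ?case
        proof (rule field_differentiable_bound[OF convex_closed_segment])
          fix x assume "x \<in> closed_segment (Complex t y) (Complex t 0)"
          note x = seg[OF this]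
          show "(B has_field_derivative f x) (at x within closed_segment (Complex t y) (Complex t 0))"
            using x elim by (intro has_field_derivative_at_within[OF B]) (auto simp: U_def)
          have "x \<noteq> 0" using x elim by auto
          then have "norm (f x) = norm (exp ((s - 1) * Ln x)) / norm (exp x - 1)"
            by (simp only: f_def powr_def norm_divide if_False)
          also have "\<dots> \<le> exp (norm ((s - 1) * Ln x)) / norm (exp x - 1)"
            by (intro divide_right_mono norm_exp norm_ge_zero)
          also have "norm ((s - 1) * Ln x) = norm (s - 1) * norm (Ln x)" by (rule norm_mult)
          finally have "norm (f x) \<le> exp (norm (s - 1) * norm (Ln x)) / norm (exp x - 1)" .
          also have "\<dots> \<le> C * exp (- (1/2) * Re x)" using x elim by (intro C) auto
          finally show "norm (f x) \<le> C * exp (- (1/2) * t)" using x by simp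
        qed auto
      qed
      have "filterlim (\<lambda>t::real. - (1/2) * t) at_bot at_top"
        by (rule filterlim_tendsto_neg_mult_at_bot[OF tendsto_const _ filterlim_ident]) simp
      then have "((\<lambda>t::real. exp (- (1/2) * t)) \<longlongrightarrow> 0) at_top"
        by (rule filterlim_compose[OF exp_at_bot])
      from tendsto_mult_left_zero[OF tendsto_mult_right_zero[OF this], of C "norm (Complex 0 y)"]
      show "((\<lambda>t. C * exp (- (1/2) * t) * norm (Complex t y - Complex t 0)) \<longlongrightarrow> 0) at_top"
        by (simp add: complex_diff)
    qed
  qed

  define g where "g = (\<lambda>t. complex_of_real t powr (s - 1) / (exp (of_real t) - 1))"
  have fg: "f (Complex t 0) = g t" for t
    by (simp add: f_def g_def complex_of_real_def)
  have g_int: "set_integrable lborel {0<..} g"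
    unfolding g_def by (rule Mellin_transform_bose(1)[OF s])
  define \<Delta> where "\<Delta> = (\<lambda>\<epsilon>. (lo - up) * B (Complex \<epsilon> 0) + (c_lo - c_up))"
  have H_eq: "H = (lo - up) * (LINT t:{\<epsilon>..}|lborel. g t) + \<Delta> \<epsilon>" if \<epsilon>: "\<epsilon> > 0" for \<epsilon>
  proof -
    define L where "L = B (Complex \<epsilon> 0) + (LINT t:{\<epsilon>..}|lborel. g t)"
    have realline: "((\<lambda>t. B (Complex t 0)) \<longlongrightarrow> L) at_top"
      unfolding L_def fg[symmetric]
    proof (rule ray_primitive_tendsto)
      show "(B has_field_derivative f (Complex t 0)) (at (Complex t 0))" if "\<epsilon> \<le> t" for t
        using that \<epsilon> by (intro B) (auto simp: U_def)
      show "continuous_on {\<epsilon>..} (\<lambda>t. f (Complex t 0))"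
        using \<epsilon> by (intro continuous_on_compose2[OF holomorphic_on_imp_continuous_on[OF f_holo] continuous_on_Complex_line])
          (auto simp: U_def)
      show "set_integrable lborel {\<epsilon>..} (\<lambda>t. f (Complex t 0))"
        unfolding fg by (rule set_integrable_subset[OF g_int]) (use \<epsilon> in auto)
    qed
    have ray: "((\<lambda>t. B (Complex t y)) \<longlongrightarrow> L) at_top" if "\<bar>y\<bar> < pi" for y
      using tendsto_add[OF vertical[OF that] realline] by simp
    have "((\<lambda>t. (lo * B (Complex t (- h)) + c_lo) - (up * B (Complex t h) + c_up)) \<longlongrightarrow>
        (lo * L + c_lo) - (up * L + c_up)) at_top"
      using hr by (intro tendsto_intros ray) auto
    moreover have "eventually (\<lambda>t. (lo * B (Complex t (- h)) + c_lo) - (up * B (Complex t h) + c_up) =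
        A (Complex t (- h)) - A (Complex t h)) at_top"
      using eventually_gt_at_top[of 0]
      by eventually_elim (use hr in \<open>auto simp: c_lo c_up U_def\<close>)
    ultimately have "((\<lambda>t. A (Complex t (- h)) - A (Complex t h)) \<longlongrightarrow> (lo * L + c_lo) - (up * L + c_up)) at_top"
      by (rule Lim_transform_eventually)
    from tendsto_unique[OF _ lim_H this] show ?thesis
      by (simp add: L_def \<Delta>_def algebra_simps)
  qed

  obtain K where K: "K \<ge> 0"
    "\<And>x. x \<in> slit_strip \<Longrightarrow> norm x \<le> 1 \<Longrightarrow> norm (bose_integrand s x) \<le> K * norm x powr (Re s - 2)"
    using bose_integrand_near_0 by metis
  have \<Delta>_bound: "norm (\<Delta> \<epsilon>) \<le> 2 * pi * K * \<epsilon> powr (Re s - 1)" if \<epsilon>: "0 < \<epsilon>" "\<epsilon> < 1" for \<epsilon>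
  proof -
    define q where "q = (\<lambda>\<eta>. sqrt (\<epsilon>\<^sup>2 - \<eta>\<^sup>2))"
    have \<epsilon>pi: "\<epsilon> < pi" using \<epsilon> pi_gt3 by simp
    \<comment> \<open>The radius is \<open>\<epsilon>\<close>; the height \<open>\<eta>\<close> of the end points will tend to \<open>0\<close>.\<close>
    have arc: "norm ((lo * B (Complex (q \<eta>) (- \<eta>)) + c_lo) - (up * B (Complex (q \<eta>) \<eta>) + c_up))
        \<le> 2 * pi * K * \<epsilon> powr (Re s - 1)" if \<eta>: "0 < \<eta>" "\<eta> < \<epsilon>" for \<eta>
    proof -
      note P = path_image_hankel_arc[OF \<eta> \<epsilon>pi]
      have q: "q \<eta> > 0" using hankel_start_pos[OF \<eta>] by (simp add: q_def)
      have "(bose_integrand s has_contour_integral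
          (A (pathfinish (hankel_arc \<epsilon> \<eta>)) - A (pathstart (hankel_arc \<epsilon> \<eta>)))) (hankel_arc \<epsilon> \<eta>)"
        by (rule contour_integral_primitive[where S = slit_strip])
           (use A P(1) in \<open>auto simp: hankel_arc_def intro: has_field_derivative_at_within\<close>)
      then have *: "(bose_integrand s has_contour_integral (A (Complex (q \<eta>) (- \<eta>)) - A (Complex (q \<eta>) \<eta>)))
          (part_circlepath 0 \<epsilon> (arcsin (\<eta> / \<epsilon>)) (2 * pi - arcsin (\<eta> / \<epsilon>)))"
        using hankel_arc_ends[OF \<eta>] by (simp add: q_def hankel_arc_def)
      have "norm (A (Complex (q \<eta>) (- \<eta>)) - A (Complex (q \<eta>) \<eta>)) \<le>
          (K * \<epsilon> powr (Re s - 2)) * \<epsilon> * (2 * pi - arcsin (\<eta> / \<epsilon>) - arcsin (\<eta> / \<epsilon>))"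
      proof (rule has_contour_integral_bound_part_circlepath[OF *])
        show "0 \<le> K * \<epsilon> powr (Re s - 2)" using K(1) by simp
        show "norm (bose_integrand s x) \<le> K * \<epsilon> powr (Re s - 2)"
          if "x \<in> path_image (part_circlepath 0 \<epsilon> (arcsin (\<eta> / \<epsilon>)) (2 * pi - arcsin (\<eta> / \<epsilon>)))" for x
          using that P K(2)[of x] \<epsilon> unfolding hankel_arc_def by fastforce
      qed (use \<epsilon> arc_angle_bounds[OF \<eta>] in auto)
      also have "\<dots> \<le> (K * \<epsilon> powr (Re s - 2)) * \<epsilon> * (2 * pi)"
        using K(1) \<epsilon> arc_angle_bounds[OF \<eta>] by (intro mult_left_mono) auto
      also have "\<dots> = 2 * pi * K * (\<epsilon> powr (Re s - 2) * \<epsilon>)" by simp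
      also have "\<epsilon> powr (Re s - 2) * \<epsilon> = \<epsilon> powr (Re s - 1)"
        using \<epsilon> powr_add[of \<epsilon> "Re s - 2" 1] by simp
      finally show ?thesis
        using q \<eta> \<epsilon>pi by (simp add: c_lo c_up U_def)
    qed
    have lim: "((\<lambda>\<eta>. B (Complex (q \<eta>) (k * \<eta>))) \<longlongrightarrow> B (Complex \<epsilon> 0)) (at_right 0)" for k
    proof (rule isCont_tendsto_compose[of _ B])
      show "isCont B (Complex \<epsilon> 0)" using \<epsilon> by (intro DERIV_isCont[OF B]) (auto simp: U_def)
      have "((\<lambda>\<eta>. Complex (sqrt (\<epsilon>\<^sup>2 - \<eta>\<^sup>2)) (k * \<eta>)) \<longlongrightarrow> Complex (sqrt (\<epsilon>\<^sup>2 - 0\<^sup>2)) (k * 0)) (at_right 0)"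
        by (intro tendsto_intros)
      then show "((\<lambda>\<eta>. Complex (q \<eta>) (k * \<eta>)) \<longlongrightarrow> Complex \<epsilon> 0) (at_right 0)"
        using \<epsilon> by (simp add: q_def)
    qed
    have "((\<lambda>\<eta>. (lo * B (Complex (q \<eta>) (- \<eta>)) + c_lo) - (up * B (Complex (q \<eta>) \<eta>) + c_up)) \<longlongrightarrow> \<Delta> \<epsilon>) (at_right 0)"
    proof -
      have "((\<lambda>\<eta>. (lo * B (Complex (q \<eta>) (- 1 * \<eta>)) + c_lo) - (up * B (Complex (q \<eta>) (1 * \<eta>)) + c_up)) \<longlongrightarrow>
          (lo * B (Complex \<epsilon> 0) + c_lo) - (up * B (Complex \<epsilon> 0) + c_up)) (at_right 0)"
        by (intro tendsto_intros lim)
      then show ?thesis by (simp add: \<Delta>_def algebra_simps)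
    qed
    then show ?thesis
    proof (rule Lim_norm_ubound[rotated])
      show "eventually (\<lambda>\<eta>. norm ((lo * B (Complex (q \<eta>) (- \<eta>)) + c_lo) - (up * B (Complex (q \<eta>) \<eta>) + c_up))
          \<le> 2 * pi * K * \<epsilon> powr (Re s - 1)) (at_right 0)"
        unfolding eventually_at_right_field using arc \<epsilon>(1) by blast
    qed simp
  qed

  define e where "e = (\<lambda>n. inverse (real (Suc (Suc n))))"
  have e: "0 < e n" "e n < 1" for n by (auto simp: e_def inverse_less_1_iff)
  have e0: "e \<longlonglongrightarrow> 0" unfolding e_def by (rule LIMSEQ_Suc[OF LIMSEQ_inverse_real_of_nat])
  have \<Delta>_lim: "(\<lambda>n. \<Delta> (e n)) \<longlonglongrightarrow> 0"
  proof (rule Lim_null_comparison)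
    show "eventually (\<lambda>n. norm (\<Delta> (e n)) \<le> 2 * pi * K * e n powr (Re s - 1)) sequentially"
      using \<Delta>_bound[OF e] by simp
    have "(\<lambda>n. e n powr (Re s - 1)) \<longlonglongrightarrow> 0"
      using s by (intro tendsto_zero_powrI[OF e0 tendsto_const]) (use e(1) in \<open>auto simp: less_imp_le\<close>)
    then show "(\<lambda>n. 2 * pi * K * e n powr (Re s - 1)) \<longlonglongrightarrow> 0" by (rule tendsto_mult_right_zero)
  qed
  have int_lim: "(\<lambda>n. LINT t:{e n..}|lborel. g t) \<longlonglongrightarrow> (LINT t:{0<..}|lborel. g t)"
    unfolding set_lebesgue_integral_def
  proof (rule integral_dominated_convergence)
    show "integrable lborel (\<lambda>t. norm (indicator {0<..} t *\<^sub>R g t))"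
      using g_int unfolding set_integrable_def by (rule integrable_norm)
    show "(\<lambda>t. indicator {0<..} t *\<^sub>R g t) \<in> borel_measurable lborel"
      using g_int unfolding set_integrable_def by (rule borel_measurable_integrable)
    show "(\<lambda>t. indicator {e n..} t *\<^sub>R g t) \<in> borel_measurable lborel" for n
    proof -
      have "set_integrable lborel {e n..} g"
        by (rule set_integrable_subset[OF g_int]) (use e(1)[of n] in auto)
      then show ?thesis unfolding set_integrable_def by (rule borel_measurable_integrable)
    qed
    show "AE t in lborel. norm (indicator {e n..} t *\<^sub>R g t) \<le> norm (indicator {0<..} t *\<^sub>R g t)" for n
      using e[of n] by (intro always_eventually) (auto simp: indicator_def)
    show "AE t in lborel. (\<lambda>n. indicator {e n..} t *\<^sub>R g t) \<longlonglongrightarrow> indicator {0<..} t *\<^sub>R g t"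
    proof (intro always_eventually allI)
      fix t :: real
      show "(\<lambda>n. indicator {e n..} t *\<^sub>R g t) \<longlonglongrightarrow> indicator {0<..} t *\<^sub>R g t"
      proof (cases "t > 0")
        case True
        have "eventually (\<lambda>n. e n < t) sequentially" using e0 True by (rule order_tendstoD)
        then have "eventually (\<lambda>n. indicator {0<..} t *\<^sub>R g t = indicator {e n..} t *\<^sub>R g t) sequentially"
          by eventually_elim (use True in auto)
        then show ?thesis by (rule Lim_transform_eventually[OF tendsto_const])
      next
        case False
        then have "indicator {e n..} t = (0::real)" for n using e[of n] by (simp add: indicator_def)
        then show ?thesis using False by simp
      qed
    qed
  qed
  have "(\<lambda>n. (lo - up) * (LINT t:{e n..}|lborel. g t) + \<Delta> (e n)) \<longlonglongrightarrow>
      (lo - up) * (LINT t:{0<..}|lborel. g t) + 0"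
    by (rule tendsto_add[OF tendsto_mult[OF tendsto_const int_lim] \<Delta>_lim])
  then have "(\<lambda>n. H) \<longlonglongrightarrow> (lo - up) * (LINT t:{0<..}|lborel. g t)"
    unfolding H_eq[OF e(1), symmetric] by (simp only: add_0_right)
  then have "H = (lo - up) * (LINT t:{0<..}|lborel. g t)"
    by (rule LIMSEQ_unique[OF tendsto_const])
  then show ?thesis by (simp only: H_def lo_def up_def g_def)
qed

section \<open>The continuation of the zeta function\<close>

lemma holomorphic_zeta_series:
  "(\<lambda>s. \<Sum>n. 1 / of_nat (Suc n) powr s) holomorphic_on {s :: complex. Re s > 1}"
proof -
  let ?S = "{s :: complex. Re s > 1}"
  have op: "open ?S" by (rule open_halfspace_Re_gt)
  obtain g where g: "\<forall>s\<in>?S. (\<lambda>n. 1 / of_nat (Suc n) powr s) sums g s \<and> g field_differentiable (at s)"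
  proof (rule series_differentiable_comparison_complex[OF op])
    show "(\<lambda>s. 1 / of_nat (Suc n) powr s) field_differentiable (at s)" for n and s :: complex
    proof -
      have "(\<lambda>s. 1 / of_nat (Suc n) powr s :: complex) holomorphic_on UNIV"
        by (intro holomorphic_intros) (auto simp del: of_nat_Suc)
      then show ?thesis by (rule holomorphic_on_imp_differentiable_at) auto
    qed
  next
    fix x :: complex assume x: "x \<in> ?S"
    define d where "d = (Re x - 1) / 2"
    define h :: "nat \<Rightarrow> complex" where "h = (\<lambda>n. of_real (1 / real (Suc n) powr (1 + d)))"
    have d: "d > 0" using x by (simp add: d_def)
    have "summable h"
      unfolding h_def summable_of_real_iff using d by (intro summable_zeta_real) simp
    moreover have "range h \<subseteq> \<real>\<^sub>\<ge>\<^sub>0" by (auto simp: h_def)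
    moreover have "norm (1 / of_nat (Suc n) powr y) \<le> norm (h n)" if "y \<in> ball x d \<inter> ?S" for n and y :: complex
    proof -
      have "\<bar>Re (x - y)\<bar> < d" using that abs_Re_le_cmod[of "x - y"] by (simp add: dist_norm)
      then have "1 + d \<le> Re y" by (simp add: d_def abs_if field_simps split: if_splits)
      then have "real (Suc n) powr (1 + d) \<le> real (Suc n) powr Re y" by (intro powr_mono) auto
      then have "1 / real (Suc n) powr Re y \<le> 1 / real (Suc n) powr (1 + d)"
        by (intro divide_left_mono) auto
      moreover have "norm (1 / of_nat (Suc n) powr y) = 1 / real (Suc n) powr Re y"
        using norm_powr_real_powr[of "of_nat (Suc n)" y] by (simp add: norm_divide del: of_nat_Suc)
      moreover have "norm (h n) = 1 / real (Suc n) powr (1 + d)" by (simp add: h_def norm_divide del: of_nat_Suc)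
      ultimately show ?thesis by simp
    qed
    ultimately show "\<exists>d (h :: nat \<Rightarrow> complex). 0 < d \<and> summable h \<and> range h \<subseteq> \<real>\<^sub>\<ge>\<^sub>0 \<and>
        (\<forall>\<^sub>F n in sequentially. \<forall>y\<in>ball x d \<inter> ?S. norm (1 / of_nat (Suc n) powr y) \<le> norm (h n))"
      using d by (intro exI[of _ d] exI[of _ h]) (auto simp del: of_nat_Suc)
  qed
  have "g holomorphic_on ?S" using g by (simp add: holomorphic_on_open op field_differentiable_def)
  then show ?thesis
    by (rule holomorphic_transform) (use g in \<open>auto simp: sums_iff\<close>)
qed

definition hankel_zeta :: "real \<Rightarrow> real \<Rightarrow> complex \<Rightarrow> complex" where
  "hankel_zeta r h s = - (Gamma (1 - s) / (2 * of_real pi * \<i>)) * hankel_integral r h (bose_integrand s)"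

text \<open>The exponentials from the two sides of the axis combine to \<open>- 2 \<i> sin (\<pi> s)\<close>, which the reflection
  formula cancels against \<open>\<Gamma>(s) \<Gamma>(1 - s)\<close>. Integers are excluded because there \<open>\<Gamma>(1 - s)\<close> has poles.\<close>

lemma hankel_zeta_eq_series:
  assumes hr: "0 < h" "h < r" "r < pi" and s: "Re s > 1" "s \<notin> \<int>"
  shows "hankel_zeta r h s = (\<Sum>n. 1 / of_nat (Suc n) powr s)"
proof -
  define Z :: complex where "Z = (\<Sum>n. 1 / of_nat (Suc n) powr s)"
  have sin: "sin (of_real pi * s) \<noteq> 0"
  proof
    assume "sin (of_real pi * s) = 0"
    then obtain n :: int where "of_real pi * s = of_real (of_int n * pi)" by (auto simp: sin_eq_0)
    then have "of_real pi * s = of_real pi * of_int n" by (simp add: mult.commute)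
    then have "s = of_int n" by simp
    with s(2) show False by auto
  qed
  have "exp (\<i> * pi * (s - 1)) - exp (- (\<i> * pi * (s - 1))) = 2 * \<i> * sin (of_real pi * (s - 1))"
    by (simp add: sin_exp_eq mult_ac)
  also have "sin (of_real pi * (s - 1)) = - sin (of_real pi * s)"
    by (simp add: right_diff_distrib sin_diff flip: sin_of_real cos_of_real)
  finally have "hankel_integral r h (bose_integrand s) = - (2 * \<i> * sin (of_real pi * s)) * (Gamma s * Z)"
    unfolding hankel_integral_bose_eq_Mellin[OF hr s(1)] Mellin_transform_bose(2)[OF s(1)] Z_def by simp
  then have "hankel_zeta r h s = (Gamma s * Gamma (1 - s)) * sin (of_real pi * s) / of_real pi * Z"
    by (simp add: hankel_zeta_def)
  also have "\<dots> = Z" using sin by (simp add: Gamma_reflection_complex)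
  finally show ?thesis by (simp only: Z_def)
qed

lemma nonpos_Int_iff_of_nat: "1 - s \<in> \<int>\<^sub>\<le>\<^sub>0 \<longleftrightarrow> (\<exists>n\<ge>1. s = of_nat n)" for s :: complex
proof
  assume "1 - s \<in> \<int>\<^sub>\<le>\<^sub>0"
  then obtain n where "1 - s = - of_nat n" by (rule nonpos_Ints_cases')
  then have "s = of_nat (Suc n)" by (simp add: algebra_simps)
  then show "\<exists>n\<ge>1. s = of_nat n" by (intro exI[of _ "Suc n"]) simp
next
  assume "\<exists>n\<ge>1. s = of_nat n"
  then obtain n where "n \<ge> 1" "s = of_nat n" by blast
  then have "1 - s = - of_nat (n - 1)" by (simp add: of_nat_diff)
  then show "1 - s \<in> \<int>\<^sub>\<le>\<^sub>0" by (metis minus_of_nat_in_nonpos_Ints)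
qed

text \<open>The Dirichlet series covers the half plane \<open>Re s > 1\<close>, and the Hankel formula covers everything
  except the positive integers. The two agree where both are defined, and together they cover the plane
  without the point \<open>1\<close>. The glued function is therefore the continuation.\<close>

lemma riemann_zeta_hankel:
  assumes hr: "0 < h" "h < r" "r < pi"
  shows "riemann_zeta holomorphic_on - {1}"
    and "1 - s \<notin> \<int>\<^sub>\<le>\<^sub>0 \<Longrightarrow> riemann_zeta s = hankel_zeta r h s"
proof -
  define R where "R = {s :: complex. Re s > 1}"
  define V where "V = {s :: complex. 1 - s \<notin> \<int>\<^sub>\<le>\<^sub>0}"
  define Z where "Z = (\<lambda>s :: complex. \<Sum>n. 1 / of_nat (Suc n) powr s)"
  define g where "g = (\<lambda>s. if Re s > 1 then Z s else hankel_zeta r h s)"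
  have "open R" unfolding R_def by (rule open_halfspace_Re_gt)
  have "open V"
  proof -
    have "V = (\<lambda>s. 1 - s) -` (- \<int>\<^sub>\<le>\<^sub>0)" by (auto simp: V_def)
    then show ?thesis
      by (simp add: open_vimage continuous_on_diff open_Compl closed_nonpos_Ints)
  qed
  have gV: "g s = hankel_zeta r h s" if "s \<in> V" for s
  proof (cases "Re s > 1")
    case True
    have "s \<notin> \<int>"
    proof
      assume "s \<in> \<int>"
      then obtain k where k: "s = of_int k" by (rule Ints_cases)
      with True have "k > 1" by simp
      with k have "s = of_nat (nat k)" "nat k \<ge> 1" by auto
      with that show False unfolding V_def nonpos_Int_iff_of_nat by blast
    qed
    then show ?thesis using hankel_zeta_eq_series[OF hr True] by (simp add: g_def Z_def True)
  qed (simp add: g_def)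
  have "hankel_zeta r h holomorphic_on V"
    unfolding hankel_zeta_def using entire_hankel_bose[OF hr]
    by (intro holomorphic_intros holomorphic_Gamma') (auto simp: V_def intro: holomorphic_on_subset)
  then have "g holomorphic_on V" by (rule holomorphic_transform) (simp add: gV)
  moreover have "g holomorphic_on R"
    using holomorphic_zeta_series unfolding R_def
    by (rule holomorphic_transform) (simp add: g_def Z_def)
  ultimately have "g holomorphic_on (R \<union> V)"
    using \<open>open R\<close> \<open>open V\<close> by (intro holomorphic_on_Un)
  also have "R \<union> V = - {1}"
  proof (intro set_eqI iffI)
    fix s :: complex assume "s \<in> R \<union> V"
    then show "s \<in> - {1}" by (auto simp: R_def V_def)
  next
    fix s :: complex assume s: "s \<in> - {1}"
    show "s \<in> R \<union> V"
    proof (rule ccontr)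
      assume "s \<notin> R \<union> V"
      then obtain n where "n \<ge> 1" "s = of_nat n" "Re s \<le> 1"
        unfolding V_def R_def nonpos_Int_iff_of_nat by auto
      with s show False by auto
    qed
  qed
  finally have g: "g holomorphic_on - {1}" .
  have eq: "riemann_zeta s = g s" if "s \<noteq> 1" for s
    unfolding riemann_zeta_def
  proof (rule continuation_eqI[OF _ _ _ _ _ _ g])
    show "connected (- {1 :: complex})" by (rule connected_punctured_universe) simp
    show "open {s :: complex. Re s > 1}" by (rule open_halfspace_Re_gt)
    show "{s :: complex. Re s > 1} \<noteq> {}" by (auto intro: exI[of _ 2])
    show "g u = (\<Sum>n. 1 / of_nat (Suc n) powr u)" if "u \<in> {s. Re s > 1}" for u
      using that by (simp add: g_def Z_def)
  qed (use that in auto)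
  show "riemann_zeta holomorphic_on - {1}"
    using g by (rule holomorphic_transform) (simp add: eq)
  show "riemann_zeta s = hankel_zeta r h s" if "1 - s \<notin> \<int>\<^sub>\<le>\<^sub>0"
  proof -
    have "s \<noteq> 1" using that by auto
    then show ?thesis using eq gV that by (simp add: V_def)
  qed
qed

lemma zeta_hankel_eq_hankel_zeta:
  assumes "0 < h" "h < r" "r < pi" "m \<ge> 2" "Re s < real m"
  shows "zeta_hankel m r h s = hankel_zeta r h s"
proof -
  have "s \<noteq> of_nat m"
  proof
    assume "s = of_nat m"
    then have "Re s = real m" by simp
    with assms show False by simp
  qed
  moreover have "Gamma (of_nat m :: complex) \<noteq> 0"
    using Gamma_fact[of "m - 1", where 'a = complex] assms by (simp add: of_nat_diff)
  ultimately show ?thesis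
    unfolding zeta_hankel_def hankel_zeta_def hankel_integral_zeta_integrand[OF assms] by simp
qed

theorem theorem2p1:
  fixes m :: nat and s :: complex and r h :: real
  assumes "m \<ge> 2" and "0 < h" and "h < r" and "r < pi"
    and "s \<noteq> 1" and "Re s < real m"
  shows "hankel_integrable r h (zeta_integrand m s)
    \<and> (s \<notin> of_nat ` {2..m - 1} \<longrightarrow> riemann_zeta s = zeta_hankel m r h s)
    \<and> (s \<in> of_nat ` {2..m - 1} \<longrightarrow> (zeta_hankel m r h \<longlongrightarrow> riemann_zeta s) (at s))"
proof (intro conjI impI)
  note hr = \<open>0 < h\<close> \<open>h < r\<close> \<open>r < pi\<close>
  show "hankel_integrable r h (zeta_integrand m s)"
    by (rule hankel_integrable_zeta_integrand) fact+
  show "riemann_zeta s = zeta_hankel m r h s" if s: "s \<notin> of_nat ` {2..m - 1}"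
  proof -
    have "1 - s \<notin> \<int>\<^sub>\<le>\<^sub>0"
    proof
      assume "1 - s \<in> \<int>\<^sub>\<le>\<^sub>0"
      then obtain n where n: "n \<ge> 1" "s = of_nat n" unfolding nonpos_Int_iff_of_nat by blast
      with \<open>s \<noteq> 1\<close> \<open>Re s < real m\<close> have "n \<noteq> 1" "n < m" by auto
      with n s show False by auto
    qed
    then show ?thesis
      using riemann_zeta_hankel(2)[OF hr] zeta_hankel_eq_hankel_zeta[OF hr] assms by simp
  qed
  show "(zeta_hankel m r h \<longlongrightarrow> riemann_zeta s) (at s)" if s: "s \<in> of_nat ` {2..m - 1}"
  proof -
    obtain k where k: "s = of_nat k" using s by blast
    have "riemann_zeta field_differentiable at s"
      by (rule holomorphic_on_imp_differentiable_at[OF riemann_zeta_hankel(1)[OF hr]]) (use assms in auto)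
    then have "(riemann_zeta \<longlongrightarrow> riemann_zeta s) (at s)"
      using field_differentiable_imp_continuous_at isContD by blast
    \<comment> \<open>A punctured disc of radius 1 around an integer contains no other integer, so the formula holds on it.\<close>
    moreover have "eventually (\<lambda>z. riemann_zeta z = zeta_hankel m r h z) (at s)"
    proof -
      have "eventually (\<lambda>z. z \<in> {z. Re z < real m}) (at s)"
        by (rule eventually_at_in_open'[OF open_halfspace_Re_lt]) (use assms in auto)
      moreover have "eventually (\<lambda>z. z \<in> ball s 1 - {s}) (at s)"
        by (rule eventually_at_in_open) auto
      ultimately show ?thesis
      proof eventually_elim
        case (elim z)
        have "1 - z \<notin> \<int>\<^sub>\<le>\<^sub>0"
        proof
          assume "1 - z \<in> \<int>\<^sub>\<le>\<^sub>0"
          then obtain n where n: "z = of_nat n" unfolding nonpos_Int_iff_of_nat by blast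
          with elim k have "n \<noteq> k" "norm (of_int (int k - int n) :: complex) < 1"
            by (auto simp: dist_norm)
          then show False by (simp only: norm_of_int)
        qed
        then show ?case
          using riemann_zeta_hankel(2)[OF hr] zeta_hankel_eq_hankel_zeta[OF hr] elim assms by simp
      qed
    qed
    ultimately show ?thesis by (rule Lim_transform_eventually)
  qed
qed

end
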